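(* Let $(a,b)\in\mathbb{Q}^2\setminus\mathbb{Z}^2$, $f=[(a,b)+\mathbb{Z}^2]$, and let $\gamma=\begin{bmatrix}\alpha&x\\\beta&y\end{bmatrix}\in\mathrm{SL}_2(\mathbb{Z})$ with $\beta>0$, so $\gamma\cdot i\infty=\alpha/\beta$. Then \[\frac{1}{2\pi i}\int_{\alpha/\beta}^{i\infty}\mathrm{dlog}(u(f))=C(\alpha,\beta,a,b)-\frac{1}{2\pi i}\big((\delta_0\otimes\mathrm{RClog})(f|\gamma)-(\delta_0\otimes\mathrm{RClog})(f)\big).\]
   Context: $q^y=e^{2\pi i y\tau}$, $\zeta^x=e^{2\pi ix}$. For $(a,b)\notin\mathbb{Z}^2$, $u(f)$ is the nowhere vanishing holomorphic function on the upper half plane $u(f)(\tau)=\prod_{y\in\mathbb{Q},\,y>0,\,y\equiv a\ (\mathrm{mod}\ \mathbb{Z})}(1-q^y\zeta^b)\prod_{y<0,\,y\equiv a\ (\mathrm{mod}\ \mathbb{Z})}(1-q^{-y}\zeta^{-b})$, and $\mathrm{dlog}(u(f))=u(f)'/u(f)\,d\tau$. The integral is along the vertical path $\alpha/\beta+it$, $t\ge0$. $(f|\gamma)(v)=f(v\gamma^{-1})$, so $f|\gamma=[(a,b)\gamma+\mathbb{Z}^2]=[(a\alpha+b\beta,ax+by)+\mathbb{Z}^2]$. For $g=[(a',b')+\mathbb{Z}^2]$ with $(a',b')\notin\mathbb{Z}^2$: $(\delta_0\otimes\mathrm{RClog})(g)=\delta_0(a')\log|1-e^{2\pi ib'}|$,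 where $\delta_0(x)=1$ if $x\in\mathbb{Z}$ and $0$ otherwise. $\mathbb{B}_1(x)=x-\lfloor x\rfloor-\frac12$ for $x\notin\mathbb{Z}$ and $\mathbb{B}_1(x)=0$ for $x\in\mathbb{Z}$. The Dedekind sum is $C(\alpha,\beta,a,b)=\sum_{\ell=0}^{\beta-1}\mathbb{B}_1\big(\tfrac{a+\ell}{\beta}\big)\mathbb{B}_1\big(b+\tfrac{\alpha}{\beta}(a+\ell)\big)$.
   Formalization: The integral from α/β to i∞ diverges at α/β for every admissible (a,b) and γ (dlog u(f) grows like a nonzero constant times dt/t²), so it is read as Hadamard's finite part: the constant term of the integral over t ≥ ε as ε → 0, whose existence is also proved. *)

theory Defs
  imports "HOL-Analysis.Analysis" "HOL-Real_Asymp.Real_Asymp"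
begin

section \<open>Characteristic functions of cosets of \<open>\<int>\<^sup>2\<close> in \<open>\<rat>\<^sup>2\<close>\<close>

definition coset_fun :: "rat \<times> rat \<Rightarrow> rat \<times> rat \<Rightarrow> int" where
  "coset_fun w = indicator {v. fst v - fst w \<in> \<int> \<and> snd v - snd w \<in> \<int>}"

text \<open>The function \<open>v \<mapsto> f (v \<gamma>\<^sup>-\<^sup>1)\<close> for the row vector \<open>v\<close> and the matrix \<open>\<gamma>\<close> of determinant 1
  with rows \<open>(\<alpha>, x)\<close> and \<open>(\<beta>, y)\<close>, whose inverse has rows \<open>(y, -x)\<close> and \<open>(-\<beta>, \<alpha>)\<close>.\<close>

definition slash :: "(rat \<times> rat \<Rightarrow> int) \<Rightarrow> int \<Rightarrow> int \<Rightarrow> int \<Rightarrow> int \<Rightarrow> rat \<times> rat \<Rightarrow> int" where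
  "slash f \<alpha> x \<beta> y =
     (\<lambda>(v1, v2). f (v1 * of_int y - v2 * of_int \<beta>, v2 * of_int \<alpha> - v1 * of_int x))"

lemma coset_fun_eqD:
  assumes "coset_fun (a, b) = coset_fun (a', b')"
  shows "a - a' \<in> \<int>" "b - b' \<in> \<int>"
proof -
  have "coset_fun (a', b') (a, b) = 1"
    using assms[symmetric] by (simp add: coset_fun_def)
  thus "a - a' \<in> \<int>" "b - b' \<in> \<int>"
    by (auto simp: coset_fun_def indicator_def split: if_splits)
qed

lemma slash_coset_fun:
  assumes "\<alpha> * y - x * \<beta> = 1"
  shows "slash (coset_fun (a, b)) \<alpha> x \<beta> y =
    coset_fun (a * of_int \<alpha> + b * of_int \<beta>, a * of_int x + b * of_int y)"
proof (rule ext, clarify)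
  fix v w :: rat
  define A X B Y :: rat where "A = of_int \<alpha>" and "X = of_int x" and "B = of_int \<beta>" and "Y = of_int y"
  have Z: "A \<in> \<int>" "X \<in> \<int>" "B \<in> \<int>" "Y \<in> \<int>"
    by (simp_all add: A_def X_def B_def Y_def)
  have det: "A * Y - X * B = 1"
    using arg_cong[OF assms, of "of_int :: int \<Rightarrow> rat"]
    by (simp add: A_def X_def B_def Y_def)
  define s t where "s = v * Y - w * B - a" and "t = w * A - v * X - b"
  define s' t' where "s' = v - (a * A + b * B)" and "t' = w - (a * X + b * Y)"
  have 1: "s' = s * A + t * B" "t' = s * X + t * Y"
    unfolding s_def t_def s'_def t'_def using det by algebra+
  have 2: "s = s' * Y - t' * B" "t = t' * A - s' * X"
    unfolding s_def t_def s'_def t'_def using det by algebra+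
  have "s \<in> \<int> \<and> t \<in> \<int> \<longleftrightarrow> s' \<in> \<int> \<and> t' \<in> \<int>"
    by (metis 1 2 Z Ints_add Ints_diff Ints_mult)
  thus "slash (coset_fun (a, b)) \<alpha> x \<beta> y (v, w) =
      coset_fun (a * of_int \<alpha> + b * of_int \<beta>, a * of_int x + b * of_int y) (v, w)"
    by (simp add: slash_def coset_fun_def indicator_def s_def t_def s'_def t'_def
                  A_def X_def B_def Y_def)
qed

section \<open>The functions \<open>u(f)\<close>\<close>

definition qpow :: "rat \<Rightarrow> complex \<Rightarrow> complex" where
  "qpow y \<tau> = exp (2 * of_real pi * \<i> * of_rat y * \<tau>)"

definition zpow :: "rat \<Rightarrow> complex" where
  "zpow x = exp (2 * of_real pi * \<i> * of_rat x)"

text \<open>The representative of \<open>a\<close> modulo \<open>\<int>\<close> in the interval \<open>(0, 1]\<close>.\<close>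

definition pos_rep :: "rat \<Rightarrow> rat" where
  "pos_rep a = a - of_int \<lceil>a\<rceil> + 1"

lemma bij_betw_pos_rep:
  "bij_betw (\<lambda>n. pos_rep a + of_nat n) UNIV {y. 0 < y \<and> y - a \<in> \<int>}"
proof (rule bij_betwI')
  fix n :: nat
  have "0 < pos_rep a"
    unfolding pos_rep_def by linarith
  hence "0 < pos_rep a + of_nat n"
    by (simp add: add_pos_nonneg)
  moreover have "pos_rep a + of_nat n - a \<in> \<int>"
    by (simp add: pos_rep_def)
  ultimately show "pos_rep a + of_nat n \<in> {y. 0 < y \<and> y - a \<in> \<int>}"
    by simp
next
  fix y assume "y \<in> {y. 0 < y \<and> y - a \<in> \<int>}"
  then obtain k where k: "y = a + of_int k" and y: "0 < y"
    by (auto elim!: Ints_cases simp: algebra_simps)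
  have "\<lceil>a\<rceil> - 1 + k \<ge> 0"
    using k y by linarith
  hence "of_nat (nat (\<lceil>a\<rceil> - 1 + k)) = (of_int (\<lceil>a\<rceil> - 1 + k) :: rat)"
    by simp
  hence "y = pos_rep a + of_nat (nat (\<lceil>a\<rceil> - 1 + k))"
    using k by (simp add: pos_rep_def)
  thus "\<exists>n\<in>UNIV. y = pos_rep a + of_nat n"
    by blast
qed auto

text \<open>The second product is indexed by the values \<open>-y > 0\<close>, which run through the positive
  elements of \<open>-a + \<int>\<close>.\<close>

definition u_prod :: "rat \<Rightarrow> rat \<Rightarrow> complex \<Rightarrow> complex" where
  "u_prod a b \<tau> =
     (\<Prod>n. 1 - qpow (pos_rep a + of_nat n) \<tau> * zpow b) *
     (\<Prod>n. 1 - qpow (pos_rep (-a) + of_nat n) \<tau> * zpow (-b))"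

definition u :: "(rat \<times> rat \<Rightarrow> int) \<Rightarrow> complex \<Rightarrow> complex" where
  "u f = (THE w. \<exists>a b. f = coset_fun (a, b) \<and> w = u_prod a b)"

definition dlog :: "(complex \<Rightarrow> complex) \<Rightarrow> complex \<Rightarrow> complex" where
  "dlog g \<tau> = deriv g \<tau> / g \<tau>"

lemma pos_rep_cong:
  assumes "a - a' \<in> \<int>"
  shows "pos_rep a = pos_rep a'"
proof -
  obtain k where "a = a' + of_int k"
    using assms by (auto elim!: Ints_cases simp: algebra_simps)
  thus ?thesis by (simp add: pos_rep_def)
qed

lemma zpow_cong:
  assumes "b - b' \<in> \<int>"
  shows "zpow b = zpow b'"
proof -
  obtain k where "b = b' + of_int k"
    using assms by (auto elim!: Ints_cases simp: algebra_simps)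
  hence "zpow b = zpow b' * exp (2 * of_real pi * \<i> * of_int k)"
    by (simp add: zpow_def of_rat_add exp_add ring_distribs)
  also have "exp (2 * of_real pi * \<i> * of_int k) = (1 :: complex)"
    using exp_integer_2pi[of "of_int k"] by (simp add: mult_ac)
  finally show ?thesis by simp
qed

lemma u_coset_fun: "u (coset_fun (a, b)) = u_prod a b"
  unfolding u_def
proof (rule the_equality)
  fix w assume "\<exists>a' b'. coset_fun (a, b) = coset_fun (a', b') \<and> w = u_prod a' b'"
  then obtain a' b' where eq: "coset_fun (a, b) = coset_fun (a', b')" and w: "w = u_prod a' b'"
    by blast
  note Z = coset_fun_eqD[OF eq]
  have "(-a) - (-a') \<in> \<int>" "(-b) - (-b') \<in> \<int>"
    using Z by (metis Ints_minus minus_diff_minus)+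
  thus "w = u_prod a b"
    using Z w by (intro ext) (simp add: u_prod_def pos_rep_cong[of a a'] pos_rep_cong[of "-a" "-a'"]
      zpow_cong[of b b'] zpow_cong[of "-b" "-b'"])
qed blast

section \<open>The boundary term \<open>\<delta>\<^sub>0 \<otimes> RClog\<close>\<close>

definition delta0 :: "rat \<Rightarrow> real" where
  "delta0 x = (if x \<in> \<int> then 1 else 0)"

definition delta0_RClog :: "(rat \<times> rat \<Rightarrow> int) \<Rightarrow> real" where
  "delta0_RClog g =
     (THE r. \<exists>a b. g = coset_fun (a, b) \<and> r = delta0 a * ln (cmod (1 - zpow b)))"

lemma delta0_RClog_coset_fun:
  "delta0_RClog (coset_fun (a, b)) = delta0 a * ln (cmod (1 - zpow b))"
  unfolding delta0_RClog_def
proof (rule the_equality)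
  fix r
  assume "\<exists>a' b'. coset_fun (a, b) = coset_fun (a', b') \<and>
            r = delta0 a' * ln (cmod (1 - zpow b'))"
  then obtain a' b' where eq: "coset_fun (a, b) = coset_fun (a', b')"
      and r: "r = delta0 a' * ln (cmod (1 - zpow b'))"
    by blast
  note Z = coset_fun_eqD[OF eq]
  have "a \<in> \<int> \<longleftrightarrow> a' \<in> \<int>"
    using Z(1) by (metis Ints_add Ints_diff diff_add_cancel diff_diff_eq2 add_diff_cancel_left')
  thus "r = delta0 a * ln (cmod (1 - zpow b))"
    using r zpow_cong[OF Z(2)] by (simp add: delta0_def)
qed blast

section \<open>Dedekind sums\<close>

definition B1 :: "rat \<Rightarrow> rat" where
  "B1 x = (if x \<in> \<int> then 0 else x - of_int \<lfloor>x\<rfloor> - 1 / 2)"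

definition dedekind_sum :: "int \<Rightarrow> int \<Rightarrow> rat \<Rightarrow> rat \<Rightarrow> rat" where
  "dedekind_sum \<alpha> \<beta> a b =
     (\<Sum>l = 0..\<beta> - 1. B1 ((a + of_int l) / of_int \<beta>) *
        B1 (b + of_int \<alpha> / of_int \<beta> * (a + of_int l)))"

section \<open>The regularized integral from a cusp to \<open>i\<infinity>\<close>\<close>

text \<open>On the path \<open>\<tau> = \<alpha>/\<beta> + i t\<close> the form \<open>dlog u(f)\<close> decays exponentially as \<open>t\<close> tends to
  infinity, but it behaves like a non-zero constant times \<open>dt / t\<^sup>2\<close> as \<open>t\<close> tends to 0:
  the constant is a non-zero multiple of the value of the second Bernoulli polynomial at the
  fractional part of \<open>a \<alpha> + b \<beta>\<close>, and that polynomial has no rational root.  The integral is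
  therefore understood as Hadamard's finite part, that is, the constant term in the expansion of
  the integral over \<open>[\<epsilon>, \<infinity>)\<close> in negative powers of \<open>\<epsilon>\<close> and \<open>ln \<epsilon>\<close>.  It is unique if it exists,
  and it is the ordinary improper integral if that converges.\<close>

definition has_fp_integral :: "(real \<Rightarrow> complex) \<Rightarrow> complex \<Rightarrow> bool" where
  "has_fp_integral \<phi> L \<longleftrightarrow>
     (\<forall>\<epsilon>>0. \<phi> absolutely_integrable_on {\<epsilon>..}) \<and>
     (\<exists>\<Lambda> c k. finite \<Lambda> \<and> \<Lambda> \<subseteq> {0<..} \<and>
        ((\<lambda>\<epsilon>. integral {\<epsilon>..} \<phi> -
              ((\<Sum>s\<in>\<Lambda>. c s * of_real (\<epsilon> powr (-s))) + k * of_real (ln \<epsilon>))) \<longlongrightarrow> L) (at_right 0))"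

definition fp_integrable :: "(real \<Rightarrow> complex) \<Rightarrow> bool" where
  "fp_integrable \<phi> \<longleftrightarrow> (\<exists>L. has_fp_integral \<phi> L)"

definition fp_integral :: "(real \<Rightarrow> complex) \<Rightarrow> complex" where
  "fp_integral \<phi> = (THE L. has_fp_integral \<phi> L)"

text \<open>The pullback of the differential \<open>g(\<tau>) d\<tau>\<close> to the path \<open>\<tau> = r + i t\<close>.\<close>

definition vertical_pullback :: "(complex \<Rightarrow> complex) \<Rightarrow> real \<Rightarrow> real \<Rightarrow> complex" where
  "vertical_pullback g r t = g (of_real r + \<i> * of_real t) * \<i>"

lemma divergent_expansion_limit:
  fixes c :: "real \<Rightarrow> complex" and k d :: complex
  assumes "finite \<Lambda>" "\<Lambda> \<subseteq> {0<..}"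
    and "((\<lambda>\<epsilon>. (\<Sum>s\<in>\<Lambda>. c s * of_real (\<epsilon> powr (-s))) + k * of_real (ln \<epsilon>)) \<longlongrightarrow> d)
           (at_right 0)"
  shows "d = 0"
  using assms
proof (induction \<Lambda> rule: finite_linorder_max_induct)
  case empty
  show ?case
  proof (cases "k = 0")
    case True
    thus ?thesis using empty.prems(2) by (simp add: tendsto_const_iff)
  next
    case False
    have "((\<lambda>\<epsilon>. k * of_real (ln \<epsilon>)) \<longlongrightarrow> d) (at_right 0)"
      using empty.prems(2) by simp
    from tendsto_Re[OF tendsto_mult[OF tendsto_const[of "inverse k"] this]]
    have "((\<lambda>\<epsilon>::real. ln \<epsilon>) \<longlongrightarrow> Re (inverse k * d)) (at_right 0)"
      using False by (simp add: mult.assoc[symmetric])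
    moreover have "filterlim (\<lambda>\<epsilon>::real. ln \<epsilon>) at_bot (at_right 0)"
      by (rule ln_at_0)
    ultimately show ?thesis
      using not_tendsto_and_filterlim_at_infinity[of "at_right (0::real)" ln]
        filterlim_mono[OF _ at_bot_le_at_infinity order.refl] by fastforce
  qed
next
  case (insert \<mu> \<Lambda>)
  have \<mu>: "\<mu> > 0" and \<Lambda>: "\<Lambda> \<subseteq> {0<..}" and notin: "\<mu> \<notin> \<Lambda>"
    using insert by auto
  define F where "F = (\<lambda>\<epsilon>. (\<Sum>s\<in>insert \<mu> \<Lambda>. c s * of_real (\<epsilon> powr (-s))) + k * of_real (ln \<epsilon>))"
  have lim0: "((\<lambda>\<epsilon>::real. \<epsilon> powr e) \<longlongrightarrow> 0) (at_right 0)" if "e > 0" for e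
    using that by real_asymp
  have limln: "((\<lambda>\<epsilon>::real. \<epsilon> powr \<mu> * ln \<epsilon>) \<longlongrightarrow> 0) (at_right 0)"
    using \<mu> by real_asymp
  have "((\<lambda>\<epsilon>. of_real (\<epsilon> powr \<mu>) * F \<epsilon>) \<longlongrightarrow> of_real 0 * d) (at_right 0)"
    unfolding F_def using insert.prems(2) lim0[OF \<mu>] by (intro tendsto_mult tendsto_of_real)
  moreover have "((\<lambda>\<epsilon>. of_real (\<epsilon> powr \<mu>) * F \<epsilon>) \<longlongrightarrow> c \<mu>) (at_right 0)"
  proof (rule Lim_transform_eventually)
    have "((\<lambda>\<epsilon>. c \<mu> + (\<Sum>s\<in>\<Lambda>. c s * of_real (\<epsilon> powr (\<mu> - s))) + k * of_real (\<epsilon> powr \<mu> * ln \<epsilon>))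
        \<longlongrightarrow> c \<mu> + (\<Sum>s\<in>\<Lambda>. c s * of_real 0) + k * of_real 0) (at_right 0)"
      using insert.hyps by (intro tendsto_intros lim0 limln) auto
    thus "((\<lambda>\<epsilon>. c \<mu> + (\<Sum>s\<in>\<Lambda>. c s * of_real (\<epsilon> powr (\<mu> - s))) + k * of_real (\<epsilon> powr \<mu> * ln \<epsilon>))
        \<longlongrightarrow> c \<mu>) (at_right 0)"
      by simp
    show "\<forall>\<^sub>F \<epsilon> in at_right 0.
        c \<mu> + (\<Sum>s\<in>\<Lambda>. c s * of_real (\<epsilon> powr (\<mu> - s))) + k * of_real (\<epsilon> powr \<mu> * ln \<epsilon>) =
        of_real (\<epsilon> powr \<mu>) * F \<epsilon>"
      using eventually_at_right_less[of "0::real"]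
    proof eventually_elim
      case (elim \<epsilon>)
      have *: "complex_of_real (\<epsilon> powr \<mu>) * (c s * of_real (\<epsilon> powr (-s))) =
          c s * of_real (\<epsilon> powr (\<mu> - s))" for s
      proof -
        have "\<epsilon> powr (\<mu> - s) = \<epsilon> powr \<mu> * \<epsilon> powr (-s)"
          by (simp flip: powr_add)
        thus ?thesis by simp
      qed
      have "of_real (\<epsilon> powr \<mu>) * F \<epsilon> =
          (\<Sum>s\<in>insert \<mu> \<Lambda>. c s * of_real (\<epsilon> powr (\<mu> - s))) + k * of_real (\<epsilon> powr \<mu> * ln \<epsilon>)"
        unfolding F_def distrib_left sum_distrib_left * by simp
      also have "\<dots> = c \<mu> + (\<Sum>s\<in>\<Lambda>. c s * of_real (\<epsilon> powr (\<mu> - s))) +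
          k * of_real (\<epsilon> powr \<mu> * ln \<epsilon>)"
        using insert.hyps(1) notin elim by simp
      finally show ?case by simp
    qed
  qed
  ultimately have "c \<mu> = 0"
    using tendsto_unique[of "at_right (0::real)"] by fastforce
  thus ?case
    using insert.IH[OF \<Lambda>] insert.prems(2) insert.hyps(1) notin by simp
qed

lemma has_fp_integral_unique:
  assumes "has_fp_integral \<phi> L" "has_fp_integral \<phi> L'"
  shows "L = L'"
proof -
  obtain \<Lambda> c k where 1: "finite \<Lambda>" "\<Lambda> \<subseteq> {0<..}"
    "((\<lambda>\<epsilon>. integral {\<epsilon>..} \<phi> -
        ((\<Sum>s\<in>\<Lambda>. c s * of_real (\<epsilon> powr (-s))) + k * of_real (ln \<epsilon>))) \<longlongrightarrow> L) (at_right 0)"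
    using assms(1) unfolding has_fp_integral_def by blast
  obtain \<Lambda>' c' k' where 2: "finite \<Lambda>'" "\<Lambda>' \<subseteq> {0<..}"
    "((\<lambda>\<epsilon>. integral {\<epsilon>..} \<phi> -
        ((\<Sum>s\<in>\<Lambda>'. c' s * of_real (\<epsilon> powr (-s))) + k' * of_real (ln \<epsilon>))) \<longlongrightarrow> L') (at_right 0)"
    using assms(2) unfolding has_fp_integral_def by blast
  define C where "C = (\<lambda>s. (if s \<in> \<Lambda>' then c' s else 0) - (if s \<in> \<Lambda> then c s else 0))"
  have ext: "(\<Sum>s\<in>\<Lambda> \<union> \<Lambda>'. (if s \<in> M then e s else 0) * g s) = (\<Sum>s\<in>M. e s * g s)"
    if "M \<subseteq> \<Lambda> \<union> \<Lambda>'" for M and e g :: "real \<Rightarrow> complex"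
    using that 1(1) 2(1) by (intro sum.mono_neutral_cong_right) auto
  have C: "(\<Sum>s\<in>\<Lambda> \<union> \<Lambda>'. C s * g s) = (\<Sum>s\<in>\<Lambda>'. c' s * g s) - (\<Sum>s\<in>\<Lambda>. c s * g s)" for g
    unfolding C_def left_diff_distrib sum_subtractf by (simp add: ext)
  have "((\<lambda>\<epsilon>. (\<Sum>s\<in>\<Lambda> \<union> \<Lambda>'. C s * of_real (\<epsilon> powr (-s))) + (k' - k) * of_real (ln \<epsilon>))
      \<longlongrightarrow> L - L') (at_right 0)"
    using tendsto_diff[OF 1(3) 2(3)] unfolding C by (simp add: algebra_simps)
  from divergent_expansion_limit[OF _ _ this] 1(1,2) 2(1,2) show ?thesis
    by simp
qed

lemma fp_integral_eqI: "has_fp_integral \<phi> L \<Longrightarrow> fp_integral \<phi> = L"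
  unfolding fp_integral_def by (blast intro: has_fp_integral_unique)

end

theory Submission
  imports Defs "HOL-Complex_Analysis.Complex_Analysis"
begin

text \<open>
  The logarithm of \<open>u(f)\<close> obtained by summing the principal logarithms of its factors vanishes at
  \<open>i\<infinity>\<close>, so the integral from \<open>\<alpha>/\<beta> + i\<epsilon>\<close> to \<open>i\<infinity>\<close> is minus its value at \<open>\<alpha>/\<beta> + i\<epsilon>\<close>, and the
  constant term of that value as \<open>\<epsilon> \<rightarrow> 0\<close> is what has to be found.  Sorting the factors by their
  index modulo \<open>\<beta>\<close> splits it into sums \<open>\<Sum>k. Log (1 - c exp (-s(x + k)))\<close> with \<open>s = 2\<pi>\<beta>\<epsilon>\<close>, a root of
  unity \<open>c\<close> and \<open>0 < x \<le> 1\<close>.  For \<open>c \<noteq> 1\<close> the Euler-Maclaurin formula gives the expansion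
  \<open>-Li\<^sub>2(c)/s + (1/2 - x) Log (1 - c) + o(1)\<close>.  The factors of the two products come in pairs
  \<open>(x, c)\<close>, \<open>(1 - x, 1/c)\<close>; since \<open>Im Log (1 - exp (2\<pi>i\<theta>)) = \<pi> B\<^sub>1(\<theta>)\<close>, a pair contributes
  \<open>-2\<pi>i B\<^sub>1(x) B\<^sub>1(\<theta>)\<close>, a term of the Dedekind sum.  The pair with \<open>c = 1\<close>, which occurs exactly if
  \<open>a\<alpha> + b\<beta>\<close> is an integer, contributes \<open>log (2 sin \<pi>x)\<close>, the boundary term at \<open>\<alpha>/\<beta>\<close>; the unpaired
  factors with \<open>x = 1\<close>, which occur exactly if \<open>a\<close> is an integer, contribute the one at \<open>i\<infinity>\<close>.
\<close>

section \<open>Sums of logarithms of factors\<close>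

definition lg :: "complex \<Rightarrow> complex \<Rightarrow> complex" where
  "lg c v = Ln (1 - c * exp (- v))"

text \<open>With \<open>c = zpow b\<close>, \<open>x = pos_rep a\<close> and
  \<open>w = -2 pi i \<tau>\<close> this is a logarithm of the first product in
  \<open>u_prod\<close>. Summing principal values of the factors fixes the branch that vanishes at i
  infinity.\<close>

definition logprod :: "complex \<Rightarrow> real \<Rightarrow> complex \<Rightarrow> complex" where
  "logprod c x w = (\<Sum>n. lg c ((of_real x + of_nat n) * w))"

text \<open>Mean value inequality on the disc of radius \<open>r\<close>, where the derivative
  \<open>-1 / (1 - z)\<close> has norm at most \<open>1 / (1 - r)\<close>.\<close>

lemma norm_Ln_one_minus_le:
  assumes "norm z \<le> r" "r < 1"
  shows "norm (Ln (1 - z)) \<le> norm z / (1 - r)"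
proof -
  have "norm (Ln (1 - z) - Ln (1 - 0)) \<le> 1 / (1 - r) * norm (z - 0)"
  proof (rule field_differentiable_bound[of "cball 0 r" "\<lambda>z. Ln (1 - z)" "\<lambda>z. - 1 / (1 - z)"])
    fix y :: complex assume y: "y \<in> cball 0 r"
    hence r: "norm y < 1" using assms by simp
    hence "Re y < 1" using complex_Re_le_cmod[of y] by linarith
    hence "1 - y \<notin> \<real>\<^sub>\<le>\<^sub>0" by (simp add: complex_nonpos_Reals_iff)
    thus "((\<lambda>z. Ln (1 - z)) has_field_derivative - 1 / (1 - y)) (at y within cball 0 r)"
      by (auto intro!: derivative_eq_intros simp: field_simps)
    have "1 - r \<le> norm (1 - y)"
      using norm_triangle_ineq2[of 1 y] y by simp
    thus "norm (- 1 / (1 - y)) \<le> 1 / (1 - r)"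
      using assms by (simp add: norm_divide frac_le)
  qed (use assms order_trans[OF norm_ge_zero assms(1)] in auto)
  thus ?thesis by simp
qed

lemma one_minus_notin_nonpos:
  fixes z :: complex
  assumes "norm z < 1"
  shows "1 - z \<notin> \<real>\<^sub>\<le>\<^sub>0"
  using assms complex_Re_le_cmod[of z] by (auto simp: complex_nonpos_Reals_iff)

lemma norm_lg_le:
  assumes "norm c = 1" "h > 0" "Re v \<ge> h"
  shows "norm (lg c v) \<le> exp (- Re v) / (1 - exp (- h))"
  using norm_Ln_one_minus_le[of "c * exp (- v)" "exp (-h)"] assms
  by (simp add: lg_def norm_mult norm_exp_eq_Re)

lemma holomorphic_lg [holomorphic_intros]:
  assumes "norm c = 1" "f holomorphic_on A" "\<And>z. z \<in> A \<Longrightarrow> Re (f z) > 0"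
  shows "(\<lambda>z. lg c (f z)) holomorphic_on A"
  unfolding lg_def using assms
  by (intro holomorphic_intros one_minus_notin_nonpos) (auto simp: norm_mult norm_exp_eq_Re)

text \<open>The threshold \<open>h\<close> separates two effects: the ratio \<open>exp (- h)\<close>
  of the geometric majorant is uniform on \<open>Re w \<ge> h\<close>, while the first factor keeps
  the exponential decay in \<open>Re w\<close> that is needed at i infinity.\<close>

lemma norm_lg_logprod_term:
  assumes "norm c = 1" "x > 0" "h > 0" "Re w \<ge> h"
  shows "norm (lg c ((of_real x + of_nat n) * w)) \<le>
    exp (- x * (Re w - h)) * (exp (- x * h) / (1 - exp (- x * h))) * exp (- h) ^ n"
proof -
  have "norm (lg c ((of_real x + of_nat n) * w)) \<le> exp (- ((x + n) * Re w)) / (1 - exp (- (x * h)))"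
    using norm_lg_le[of c "x * h" "(of_real x + of_nat n) * w"] assms
    by (simp add: mult_mono)
  also have "- ((x + n) * Re w) \<le> - x * (Re w - h) - x * h - n * h"
    using mult_left_mono[of h "Re w" n] assms by (simp add: algebra_simps)
  also have "exp (- x * (Re w - h) - x * h - n * h) / (1 - exp (- (x * h))) =
    exp (- x * (Re w - h)) * (exp (- x * h) / (1 - exp (- x * h))) * exp (- h) ^ n"
    by (simp flip: exp_add exp_of_nat_mult)
  finally show ?thesis using assms by (simp add: divide_right_mono)
qed

lemma summable_logprod:
  assumes "norm c = 1" "x > 0" "Re w > 0"
  shows "summable (\<lambda>n. lg c ((of_real x + of_nat n) * w))"
proof (rule summable_comparison_test')
  show "summable (\<lambda>n. exp (- x * (Re w - Re w)) * (exp (- x * Re w) / (1 - exp (- x * Re w)))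
      * exp (- Re w) ^ n)"
    using assms by (intro summable_mult summable_geometric) auto
  show "norm (lg c ((of_real x + of_nat n) * w)) \<le>
      exp (- x * (Re w - Re w)) * (exp (- x * Re w) / (1 - exp (- x * Re w))) * exp (- Re w) ^ n"
          for n
    using norm_lg_logprod_term[of c x "Re w" w n] assms by simp
qed

lemma norm_logprod_le:
  assumes "norm c = 1" "x > 0" "h > 0" "Re w \<ge> h"
  shows "norm (logprod c x w) \<le>
    exp (- x * (Re w - h)) * (exp (- x * h) / (1 - exp (- x * h)) / (1 - exp (- h)))"
proof -
  have "(\<lambda>n. exp (- x * (Re w - h)) * (exp (- x * h) / (1 - exp (- x * h))) * exp (- h) ^ n) sums
     (exp (- x * (Re w - h)) * (exp (- x * h) / (1 - exp (- x * h))) * (1 / (1 - exp (- h))))"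
    using assms by (intro sums_mult geometric_sums) auto
  moreover have "norm (logprod c x w) \<le> (\<Sum>n. exp (- x * (Re w - h)) * (exp (- x * h) / (1 -
      exp (- x * h))) * exp (- h) ^ n)"
    unfolding logprod_def
    by (intro norm_suminf_le norm_lg_logprod_term assms sums_summable[OF calculation])
  ultimately show ?thesis by (simp add: sums_iff)
qed

lemma holomorphic_logprod:
  assumes "norm c = 1" "x > 0"
  shows "logprod c x holomorphic_on {w. Re w > 0}"
proof -
  have "open {w. Re w > 0}" by (rule open_halfspace_Re_gt)
  moreover have "(\<lambda>w. lg c ((of_real x + of_nat n) * w)) field_differentiable at w"
      if "w \<in> {w. Re w > 0}" for n w
  proof -
    have "(\<lambda>w. lg c ((of_real x + of_nat n) * w)) holomorphic_on {w. Re w > 0}"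
      using assms by (intro holomorphic_intros) (auto intro!: mult_pos_pos add_pos_nonneg)
    thus ?thesis using that calculation holomorphic_on_imp_differentiable_at by blast
  qed
  moreover have "\<exists>d h. 0 < d \<and> summable h \<and> range h \<subseteq> \<real>\<^sub>\<ge>\<^sub>0 \<and>
     (\<forall>\<^sub>F n in sequentially. \<forall>y\<in>ball w d \<inter> {w. Re w > 0}. cmod (lg c ((of_real x + of_nat n) * y))
       \<le> cmod (h n))"
    if "w \<in> {w. Re w > 0}" for w
  proof -
    \<comment> \<open>On the ball of radius \<open>Re w / 2\<close> the real part stays at least
      \<open>h\<close>, so a single geometric majorant serves there.\<close>
    define h where "h = Re w / 2"
    define K where "K = exp (- x * h) / (1 - exp (- x * h))"
    have h: "h > 0" using that by (simp add: h_def)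
    have K: "K \<ge> 0" using assms h by (simp add: K_def)
    have "cmod (lg c ((of_real x + of_nat n) * y)) \<le> cmod (of_real (K * exp (- h) ^ n))"
      if "y \<in> ball w h \<inter> {w. Re w > 0}" for n y
    proof -
      have "Re w - Re y \<le> dist w y"
        using complex_Re_le_cmod[of "w - y"] by (simp add: dist_norm)
      hence y: "Re y \<ge> h" using that by (simp add: h_def)
      have "cmod (lg c ((of_real x + of_nat n) * y)) \<le> exp (- x * (Re y - h)) * (K * exp (- h) ^ n)"
        using norm_lg_logprod_term[OF assms h y, of n] by (simp add: K_def mult.assoc)
      also have "\<dots> \<le> 1 * (K * exp (- h) ^ n)"
        using y assms K by (intro mult_right_mono) auto
      finally show ?thesis using K by (simp add: norm_mult norm_power)
    qed
    moreover have "summable (\<lambda>n. complex_of_real (K * exp (- h) ^ n))"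
      using h by (intro summable_of_real summable_mult summable_geometric) auto
    moreover have "range (\<lambda>n. complex_of_real (K * exp (- h) ^ n)) \<subseteq> \<real>\<^sub>\<ge>\<^sub>0"
      using K by auto
    ultimately show ?thesis using h
      by (intro exI[of _ h] exI[of _ "\<lambda>n. complex_of_real (K * exp (- h) ^ n)"]) auto
  qed
  ultimately obtain g where g: "\<forall>w \<in> {w. Re w > 0}. ((\<lambda>n. lg c ((of_real x + of_nat n) * w))
      sums g w) \<and> g field_differentiable (at w)"
    by (rule series_differentiable_comparison_complex)
  hence "g holomorphic_on {w. Re w > 0}"
    by (auto simp: holomorphic_on_def intro: field_differentiable_at_within)
  thus ?thesis
    by (rule holomorphic_transform) (use g in \<open>auto simp: logprod_def sums_iff\<close>)
qed

lemma exp_logprod: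
  assumes "norm c = 1" "x > 0" "Re w > 0"
  shows "exp (logprod c x w) = (\<Prod>n. 1 - c * exp (- ((of_real x + of_nat n) * w)))"
proof -
  have "exp (lg c ((of_real x + of_nat n) * w)) = 1 - c * exp (- ((of_real x + of_nat n) * w))"
      for n
  proof -
    have "(x + n) * Re w > 0"
      using assms by (intro mult_pos_pos add_pos_nonneg) auto
    hence "norm (c * exp (- ((of_real x + of_nat n) * w))) < 1"
      using assms by (simp add: norm_mult norm_exp_eq_Re)
    from one_minus_notin_nonpos[OF this] show ?thesis
      unfolding lg_def by (intro exp_Ln) auto
  qed
  with prodinf_exp[OF summable_logprod[OF assms]] show ?thesis
    by (simp add: logprod_def)
qed

text \<open>The last hypothesis says that \<open>m * Im w\<close> is a multiple of 2 pi. Hence the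
  phase of the factor of index \<open>k * m + l\<close> depends on \<open>l\<close> alone and can be
  absorbed into \<open>c\<close>; what remains is a product of the same kind at the real point
  \<open>m * Re w\<close>, with offset \<open>(x + l) / m\<close>.\<close>

lemma logprod_regroup:
  fixes x :: real and w :: complex and m :: nat
  assumes "norm c = 1" "x > 0" "Re w > 0" "m > 0"
    and "exp (of_nat m * w) = of_real (exp (m * Re w))"
  shows "logprod c x w = (\<Sum>l<m. logprod (c * exp (- ((of_real x + of_nat l)
      * \<i> * of_real (Im w)))) ((x + l) / m) (of_real (m * Re w)))"
proof -
  define c' where "c' = (\<lambda>l::nat. c * exp (- ((of_real x + of_nat l) * \<i> * of_real (Im w))))"
  have c': "norm (c' l) = 1" for l
    using assms by (simp add: c'_def norm_mult norm_exp_eq_Re)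
  have "exp (of_nat m * (\<i> * of_real (Im w))) * of_real (exp (m * Re w)) = exp (of_nat m * w)"
    by (subst (3) complex_eq) (simp add: exp_add distrib_left mult_ac flip: exp_of_real)
  hence *: "exp (of_nat m * (\<i> * of_real (Im w))) = 1" using assms(5) by simp
  have summand: "lg c ((of_real x + of_nat (k * m + l)) * w) =
      lg (c' l) ((of_real ((x + l) / m) + of_nat k) * of_real (m * Re w))" for k l
  proof -
    have "(of_real x + of_nat (k * m + l)) * w =
       ((of_real ((x + l) / m) + of_nat k) * of_real (m * Re w)) +
       (of_real x + of_nat l) * \<i> * of_real (Im w) + of_nat k * (of_nat m * (\<i> * of_real (Im w)))"
      using assms by (subst complex_eq) (simp add: field_simps)
    moreover have "exp (of_nat k * (of_nat m * (\<i> * of_real (Im w)))) = 1"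
      by (simp only: exp_of_nat_mult[of k] * power_one)
    ultimately have "exp (- ((of_real x + of_nat (k * m + l)) * w)) =
       exp (- ((of_real x + of_nat l) * \<i> * of_real (Im w))) *
       exp (- ((of_real ((x + l) / m) + of_nat k) * of_real (m * Re w)))"
      by (simp only: exp_add exp_minus inverse_mult_distrib inverse_1 mult_1_left mult_1_right
          mult.commute)
    thus ?thesis by (simp add: lg_def c'_def mult.assoc)
  qed
  have "(\<lambda>k. \<Sum>n=k*m..<k*m+m. lg c ((of_real x + of_nat n) * w)) sums logprod c x w"
    unfolding logprod_def by (intro sums_group summable_sums summable_logprod assms)
  moreover have "(\<Sum>n=k*m..<k*m+m. lg c ((of_real x + of_nat n) * w)) =
    (\<Sum>l<m. lg (c' l) ((of_real ((x + l) / m) + of_nat k) * of_real (m * Re w)))" for k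
    using sum.shift_bounds_nat_ivl[of "\<lambda>n. lg c ((of_real x + of_nat n) * w)" 0 "k*m" m]
    unfolding summand[symmetric] by (simp add: add_ac atLeast0LessThan)
  ultimately have "(\<lambda>k. \<Sum>l<m. lg (c' l) ((of_real ((x + l) / m) + of_nat k) * of_real (m * Re w)))
      sums logprod c x w"
    by simp
  moreover have "(\<lambda>k. \<Sum>l<m. lg (c' l) ((of_real ((x + l) / m) + of_nat k) * of_real (m * Re w)))
      sums
    (\<Sum>l<m. logprod (c' l) ((x + l) / m) (of_real (m * Re w)))"
    unfolding logprod_def using assms c'
    by (intro sums_sum summable_sums summable_logprod) auto
  ultimately show ?thesis unfolding c'_def by (rule sums_unique2)
qed

section \<open>The dilogarithm as a primitive, and the Euler-Maclaurin estimate on a cell\<close>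

text \<open>The dilogarithm of \<open>c exp (-v)\<close>.\<close>

definition dilog :: "complex \<Rightarrow> complex \<Rightarrow> complex" where
  "dilog c v = (\<Sum>n. c ^ Suc n * exp (- (of_nat (Suc n) * v)) / of_nat (Suc n) ^ 2)"

lemma summable_inverse_Suc_squares: "summable (\<lambda>n. 1 / real (Suc n) ^ 2)"
  using inverse_squares_sums by (simp add: sums_iff add_ac)

lemma norm_dilog_term_le:
  assumes "norm c = 1" "Re v \<ge> 0"
  shows "norm (c ^ Suc n * exp (- (of_nat (Suc n) * v)) / of_nat (Suc n) ^ 2) \<le>
      exp (- Re v) * (1 / real (Suc n) ^ 2)"
proof -
  have "exp (- (real (Suc n) * Re v)) \<le> exp (- Re v)"
    using assms mult_right_mono[of 1 "real (Suc n)" "Re v"] by simp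
  thus ?thesis using assms
    by (simp add: norm_mult norm_power norm_divide divide_right_mono del: of_nat_Suc power_Suc)
qed

lemma norm_dilog_le:
  assumes "norm c = 1" "Re v \<ge> 0"
  shows "norm (dilog c v) \<le> exp (- Re v) * (\<Sum>n. 1 / real (Suc n) ^ 2)"
  unfolding dilog_def suminf_mult[OF summable_inverse_Suc_squares, symmetric]
  by (intro norm_suminf_le norm_dilog_term_le assms summable_mult summable_inverse_Suc_squares)

lemma dilog_tendsto_0:
  assumes "norm c = 1"
  shows "((\<lambda>v. dilog c (of_real v)) \<longlongrightarrow> 0) at_top"
proof (rule Lim_null_comparison)
  show "\<forall>\<^sub>F v in at_top. norm (dilog c (of_real v)) \<le> exp (- v) * (\<Sum>n. 1 / real (Suc n) ^ 2)"
    using eventually_ge_at_top[of 0]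
    by eventually_elim (metis norm_dilog_le[OF assms] Re_complex_of_real)
  have "((\<lambda>v::real. exp (- v)) \<longlongrightarrow> 0) at_top"
    by (rule filterlim_compose[OF exp_at_bot filterlim_uminus_at_bot_at_top])
  thus "((\<lambda>v. exp (- v) * (\<Sum>n. 1 / real (Suc n) ^ 2)) \<longlongrightarrow> 0) at_top"
    by (rule tendsto_mult_left_zero)
qed

text \<open>Continuity up to the imaginary axis matters: the first cell of the Euler-Maclaurin sum
  starts at 0, and \<open>dilog c 0\<close> becomes the coefficient of the \<open>1 / s\<close>
  term.\<close>

lemma continuous_on_dilog:
  assumes "norm c = 1"
  shows "continuous_on {v. Re v \<ge> 0} (dilog c)"
proof (rule uniform_limit_theorem)
  show "uniform_limit {v. Re v \<ge> 0} (\<lambda>N v. \<Sum>n<N. c ^ Suc n * exp (- (of_nat (Suc n) * v))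
      / of_nat (Suc n) ^ 2) (dilog c) sequentially"
    unfolding dilog_def
  proof (rule Weierstrass_m_test)
    show "norm (c ^ Suc n * exp (- (of_nat (Suc n) * v)) / of_nat (Suc n) ^ 2) \<le>
        1 / real (Suc n) ^ 2"
      if "v \<in> {v. Re v \<ge> 0}" for n v
    proof -
      have "exp (- Re v) * (1 / real (Suc n) ^ 2) \<le> 1 * (1 / real (Suc n) ^ 2)"
        using that by (intro mult_right_mono) auto
      with norm_dilog_term_le[OF assms, of v n] that show ?thesis by simp
    qed
  qed (rule summable_inverse_Suc_squares)
qed (auto intro!: always_eventually continuous_intros simp del: of_nat_Suc)

text \<open>Termwise differentiation removes one power of \<open>Suc n\<close> from the denominator
  and leaves the Taylor series of \<open>Ln (1 - z)\<close> at
  \<open>z = c * exp (- v)\<close>.\<close>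

lemma dilog_has_field_derivative:
  assumes "norm c = 1" "Re v > 0"
  shows "(dilog c has_field_derivative lg c v) (at v)"
proof -
  have S: "open {v. Re v > 0}" by (rule open_halfspace_Re_gt)
  have "\<exists>g g'. \<forall>v \<in> {v. Re v > 0}.
      ((\<lambda>n. c ^ Suc n * exp (- (of_nat (Suc n) * v)) / of_nat (Suc n) ^ 2) sums g v) \<and>
      ((\<lambda>n. - (c ^ Suc n * exp (- (of_nat (Suc n) * v)) / of_nat (Suc n))) sums g' v) \<and>
        (g has_field_derivative g' v) (at v)"
  proof (rule series_and_derivative_comparison_complex[OF S])
    show "((\<lambda>v. c ^ Suc n * exp (- (of_nat (Suc n) * v)) / of_nat (Suc n) ^ 2) has_field_derivative
            - (c ^ Suc n * exp (- (of_nat (Suc n) * v)) / of_nat (Suc n))) (at v)" for n v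
      by (auto intro!: derivative_eq_intros simp: power2_eq_square simp del: of_nat_Suc power_Suc)
    have "norm (c ^ Suc n * exp (- (of_nat (Suc n) * v)) / of_nat (Suc n) ^ 2) \<le>
        norm (complex_of_real (1 / real (Suc n) ^ 2))"
      if "v \<in> {v. Re v > 0}" for n v
    proof -
      have "exp (- Re v) * (1 / real (Suc n) ^ 2) \<le> 1 * (1 / real (Suc n) ^ 2)"
        using that by (intro mult_right_mono) auto
      with norm_dilog_term_le[OF assms(1), of v n] that show ?thesis
          by (simp only: norm_of_real) simp
    qed
    moreover have "summable (\<lambda>n. complex_of_real (1 / real (Suc n) ^ 2))"
      by (intro summable_of_real summable_inverse_Suc_squares)
    moreover have "range (\<lambda>n. complex_of_real (1 / real (Suc n) ^ 2)) \<subseteq> \<real>\<^sub>\<ge>\<^sub>0"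
      by (auto simp only: nonneg_Reals_of_real_iff) simp
    ultimately show "\<exists>d h. 0 < d \<and> summable h \<and> range h \<subseteq> \<real>\<^sub>\<ge>\<^sub>0 \<and>
      (\<forall>\<^sub>F n in sequentially. \<forall>y\<in>ball w d \<inter> {v. Re v > 0}.
        cmod (c ^ Suc n * exp (- (of_nat (Suc n) * y)) / of_nat (Suc n) ^ 2) \<le> cmod (h n))" for w
      by (intro exI[of _ 1] exI[of _ "\<lambda>n. complex_of_real (1 / real (Suc n) ^ 2)"]) auto
  qed
  then obtain g g' where g: "\<And>v. Re v > 0 \<Longrightarrow> (\<lambda>n. c ^ Suc n * exp (- (of_nat (Suc n) * v))
      / of_nat (Suc n) ^ 2) sums g v"
     and g': "\<And>v. Re v > 0 \<Longrightarrow> (\<lambda>n. - (c ^ Suc n * exp (- (of_nat (Suc n) * v)) / of_nat (Suc n)))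
         sums g' v"
     and der: "\<And>v. Re v > 0 \<Longrightarrow> (g has_field_derivative g' v) (at v)"
    by force
  have "norm (- (c * exp (- v))) < 1"
    using assms by (simp add: norm_mult norm_exp_eq_Re)
  from Ln_series'[OF this] have "(\<lambda>n. - ((c * exp (- v)) ^ n) / of_nat n) sums lg c v"
    by (simp add: lg_def)
  \<comment> \<open>The term of index 0 has denominator 0 and therefore equals 0, so dropping it
    does not change the sum.\<close>
  hence "(\<lambda>n. - ((c * exp (- v)) ^ Suc n) / of_nat (Suc n)) sums lg c v"
    by (subst sums_Suc_iff) simp
  moreover have "- ((c * exp (- v)) ^ Suc n) / of_nat (Suc n) =
      - (c ^ Suc n * exp (- (of_nat (Suc n) * v)) / of_nat (Suc n))" for n
  proof -
    have "exp (- v) ^ Suc n = exp (- (of_nat (Suc n) * v))"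
      by (subst exp_of_nat_mult[symmetric]) simp
    thus ?thesis by (simp only: power_mult_distrib) simp
  qed
  ultimately have "(\<lambda>n. - (c ^ Suc n * exp (- (of_nat (Suc n) * v)) / of_nat (Suc n))) sums lg c v"
    by (simp only:)
  from sums_unique2[OF g'[OF assms(2)] this] have "g' v = lg c v" .
  with der[OF assms(2)] have "(g has_field_derivative lg c v) (at v)" by simp
  thus ?thesis
    by (rule has_field_derivative_transform_within_open[OF _ S])
       (use g assms in \<open>auto simp: dilog_def sums_iff\<close>)
qed

lemma dilog_has_vector_derivative:
  assumes "norm c = 1" "v > 0"
  shows "((\<lambda>v. dilog c (of_real v)) has_vector_derivative lg c (of_real v)) (at v)"
  using assms by (intro has_vector_derivative_real_field dilog_has_field_derivative) auto

lemma continuous_on_dilog_real: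
  assumes "norm c = 1" "A \<subseteq> {0..}"
  shows "continuous_on A (\<lambda>v. dilog c (of_real v))"
  by (rule continuous_on_compose2[OF continuous_on_dilog[OF assms(1)]])
     (use assms in \<open>auto intro!: continuous_intros\<close>)

section \<open>Taylor and Euler-Maclaurin estimates on one cell\<close>

lemma taylor_cell:
  fixes F \<Phi> F1 :: "real \<Rightarrow> 'a :: real_inner" and u :: real
  assumes s: "s > 0"
    and cont: "continuous_on {u..u+s} \<Phi>" "continuous_on {u..u+s} F"
    and der: "\<And>v. u < v \<Longrightarrow> v < u + s \<Longrightarrow> (\<Phi> has_vector_derivative F v) (at v)"
      "\<And>v. u < v \<Longrightarrow> v < u + s \<Longrightarrow> (F has_vector_derivative F1 v) (at v)"
    and bd: "\<And>v. u < v \<Longrightarrow> v < u + s \<Longrightarrow> norm (F1 v - D) \<le> M"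
  shows taylor_cell_deriv: "0 \<le> x \<Longrightarrow> x \<le> 1 \<Longrightarrow> norm (F (u + x * s) - F u - (x * s) *\<^sub>R D) \<le> M * s"
    and taylor_cell_integral: "norm (\<Phi> (u + s) - \<Phi> u - s *\<^sub>R F u - (s ^ 2 / 2) *\<^sub>R D) \<le> M * s ^ 2"
proof -
  have M: "M \<ge> 0"
    using order_trans[OF norm_ge_zero bd[of "u + s / 2"]] s by simp
  have 1: "norm (F (u + r) - F u - r *\<^sub>R D) \<le> M * r" if r: "0 < r" "r \<le> s" for r
  proof -
    have "\<exists>v\<in>{u<..<u+r}. norm ((F (u + r) - (u + r) *\<^sub>R D) - (F u - u *\<^sub>R D)) \<le>
        norm ((u + r - u) *\<^sub>R (F1 v - D))"
    proof (rule mvt_general[of _ _ "\<lambda>v. F v - v *\<^sub>R D" "\<lambda>v h. h *\<^sub>R (F1 v - D)"])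
      show "continuous_on {u..u + r} (\<lambda>v. F v - v *\<^sub>R D)"
        using r by (intro continuous_intros continuous_on_subset[OF cont(2)]) auto
      show "((\<lambda>v. F v - v *\<^sub>R D) has_derivative (\<lambda>h. h *\<^sub>R (F1 v - D))) (at v)"
          if "u < v" "v < u + r" for v
        using der(2)[of v] that r unfolding has_vector_derivative_def
        by (auto intro!: derivative_eq_intros simp: algebra_simps)
    qed (use r in auto)
    then obtain v where v: "v \<in> {u<..<u+r}" "norm ((F (u + r) - (u + r) *\<^sub>R D) - (F u - u *\<^sub>R D))
        \<le> norm ((u + r - u) *\<^sub>R (F1 v - D))"
      by blast
    have "norm ((u + r - u) *\<^sub>R (F1 v - D)) \<le> r * M"
      using bd[of v] v(1) r by (simp add: mult_left_mono)
    with v(2) have "norm ((F (u + r) - (u + r) *\<^sub>R D) - (F u - u *\<^sub>R D)) \<le> r * M" by linarith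
    thus ?thesis by (simp add: algebra_simps)
  qed
  show "norm (F (u + x * s) - F u - (x * s) *\<^sub>R D) \<le> M * s" if "0 \<le> x" "x \<le> 1"
  proof (cases "x = 0")
    case False
    have xs: "x * s \<le> s" using that s by simp
    have "norm (F (u + x * s) - F u - (x * s) *\<^sub>R D) \<le> M * (x * s)"
      using 1[of "x * s"] that s xs False by simp
    also have "\<dots> \<le> M * s" using xs M by (intro mult_left_mono)
    finally show ?thesis .
  qed (use M s in auto)
  \<comment> \<open>The derivative of this remainder at \<open>v\<close> is the first-order
    remainder of \<open>F\<close>, which the first part bounds by \<open>M * s\<close>; the mean
    value inequality supplies the second factor \<open>s\<close>.\<close>
  define \<Psi> where "\<Psi> = (\<lambda>v. \<Phi> v - (v - u) *\<^sub>R F u - ((v - u) ^ 2 / 2) *\<^sub>R D)"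
  have "\<exists>v\<in>{u<..<u+s}. norm (\<Psi> (u + s) - \<Psi> u) \<le> norm ((u + s - u) *\<^sub>R (F v - F u - (v - u) *\<^sub>R D))"
  proof (rule mvt_general[of _ _ \<Psi> "\<lambda>v h. h *\<^sub>R (F v - F u - (v - u) *\<^sub>R D)"])
    show "continuous_on {u..u + s} \<Psi>"
      unfolding \<Psi>_def using cont(1) by (intro continuous_intros) auto
    show "(\<Psi> has_derivative (\<lambda>h. h *\<^sub>R (F v - F u - (v - u) *\<^sub>R D))) (at v)"
        if "u < v" "v < u + s" for v
    proof -
      have "((\<lambda>v. (v - u)\<^sup>2 / 2) has_real_derivative v - u) (at v)"
        by (auto intro!: derivative_eq_intros)
      hence 1: "((\<lambda>v. ((v - u)\<^sup>2 / 2) *\<^sub>R D) has_derivative (\<lambda>h. ((v - u) * h) *\<^sub>R D)) (at v)"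
        unfolding has_field_derivative_def by (rule has_derivative_scaleR_left)
      have 2: "((\<lambda>v. (v - u) *\<^sub>R F u) has_derivative (\<lambda>h. h *\<^sub>R F u)) (at v)"
        by (auto intro!: derivative_eq_intros)
      have 3: "(\<Phi> has_derivative (\<lambda>h. h *\<^sub>R F v)) (at v)"
        using der(1)[of v] that by (simp add: has_vector_derivative_def)
      from has_derivative_diff[OF has_derivative_diff[OF 3 2] 1] show ?thesis
        by (simp add: \<Psi>_def algebra_simps)
    qed
  qed (use s in auto)
  then obtain v where v: "v \<in> {u<..<u+s}" "norm (\<Psi> (u + s) - \<Psi> u) \<le>
      norm ((u + s - u) *\<^sub>R (F v - F u - (v - u) *\<^sub>R D))"
    by blast
  have "norm (F v - F u - (v - u) *\<^sub>R D) \<le> M * (v - u)" using 1[of "v - u"] v by simp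
  also have "\<dots> \<le> M * s" using v M by (intro mult_left_mono) auto
  finally have "norm ((u + s - u) *\<^sub>R (F v - F u - (v - u) *\<^sub>R D)) \<le> s * (M * s)"
    using s by simp
  with v(2) have "norm (\<Psi> (u + s) - \<Psi> u) \<le> s * (M * s)" by linarith
  thus "norm (\<Phi> (u + s) - \<Phi> u - s *\<^sub>R F u - (s ^ 2 / 2) *\<^sub>R D) \<le> M * s ^ 2"
    by (simp add: \<Psi>_def power2_eq_square mult_ac diff_diff_eq add_ac)
qed

text \<open>For a pair symmetric about the midpoint the endpoint values of \<open>F\<close> drop out, which allows
  functions with a singularity at \<open>0\<close>.\<close>

lemma euler_maclaurin_cell:
  fixes F \<Phi> F1 :: "real \<Rightarrow> 'a :: real_inner" and u :: real
  assumes s: "s > 0" and x: "0 \<le> x" "x \<le> 1"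
    and cont: "continuous_on {u..u+s} \<Phi>" "continuous_on {u..u+s} F"
    and der: "\<And>v. u < v \<Longrightarrow> v < u + s \<Longrightarrow> (\<Phi> has_vector_derivative F v) (at v)"
      "\<And>v. u < v \<Longrightarrow> v < u + s \<Longrightarrow> (F has_vector_derivative F1 v) (at v)"
    and bd: "\<And>v. u < v \<Longrightarrow> v < u + s \<Longrightarrow> norm (F1 v - D) \<le> M"
  shows euler_maclaurin_cell_single: "norm (F (u + x * s) - (1 / s) *\<^sub>R (\<Phi> (u + s) - \<Phi> u) - (x -
      1/2) *\<^sub>R (F (u + s) - F u)) \<le> 3 * (M * s)"
    and euler_maclaurin_cell_pair: "norm (F (u + x * s) + F (u + (1 - x) * s) - (2 / s)
        *\<^sub>R (\<Phi> (u + s) - \<Phi> u)) \<le> 4 * (M * s)"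
proof -
  note T = taylor_cell[OF s cont der bd]
  define e where "e = (\<lambda>x. F (u + x * s) - F u - (x * s) *\<^sub>R D)"
  define e3 where "e3 = (1 / s) *\<^sub>R (\<Phi> (u + s) - \<Phi> u - s *\<^sub>R F u - (s ^ 2 / 2) *\<^sub>R D)"
  have e: "norm (e x) \<le> M * s" if "0 \<le> x" "x \<le> 1" for x
    unfolding e_def using T(1) that by blast
  have "norm e3 \<le> (1 / s) * (M * s ^ 2)"
    unfolding e3_def norm_scaleR using s T(2) by (auto intro!: divide_right_mono)
  hence e3: "norm e3 \<le> M * s" using s by (simp add: power2_eq_square)
  have eq3: "(1 / s) *\<^sub>R (\<Phi> (u + s) - \<Phi> u) = e3 + F u + (s / 2) *\<^sub>R D"
    using s by (simp add: e3_def algebra_simps power2_eq_square)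
  have eq: "F (u + x * s) = e x + F u + (x * s) *\<^sub>R D" for x
    by (simp add: e_def)
  \<comment> \<open>The terms in \<open>D\<close> cancel, because
    \<open>x * s - s / 2 = (x - 1/2) * s\<close>; only the Taylor remainders are left.\<close>
  have "F (u + x * s) - (1 / s) *\<^sub>R (\<Phi> (u + s) - \<Phi> u) - (x - 1/2) *\<^sub>R (F (u + s) - F u) =
      e x - e3 - (x - 1/2) *\<^sub>R e 1"
    using eq[of 1] unfolding eq3 eq[of x] by (simp add: algebra_simps)
  also have "norm \<dots> \<le> norm (e x) + norm e3 + norm ((x - 1/2) *\<^sub>R e 1)"
    by (meson add_mono_thms_linordered_semiring(3) norm_triangle_ineq4 order_trans)
  also have "norm ((x - 1/2) *\<^sub>R e 1) \<le> 1 * norm (e 1)"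
    unfolding norm_scaleR using x by (intro mult_right_mono) auto
  finally show "norm (F (u + x * s) - (1 / s) *\<^sub>R (\<Phi> (u + s) - \<Phi> u) - (x - 1/2) *\<^sub>R (F (u + s) -
      F u)) \<le> 3 * (M * s)"
    using e[of x] e[of 1] e3 x by simp
  have "(2 / s) *\<^sub>R (\<Phi> (u + s) - \<Phi> u) = 2 *\<^sub>R ((1 / s) *\<^sub>R (\<Phi> (u + s) - \<Phi> u))" by simp
  \<comment> \<open>Here the terms in \<open>D\<close> cancel because the two offsets
    \<open>x * s\<close> and \<open>(1 - x) * s\<close> add up to \<open>s\<close>.\<close>
  hence "F (u + x * s) + F (u + (1 - x) * s) - (2 / s) *\<^sub>R (\<Phi> (u + s) - \<Phi> u) =
      e x + e (1 - x) - 2 *\<^sub>R e3"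
    unfolding eq3 eq[of x] eq[of "1-x"] by (simp add: algebra_simps scaleR_2)
  also have "norm \<dots> \<le> norm (e x) + norm (e (1 - x)) + norm (2 *\<^sub>R e3)"
    by (meson add_mono_thms_linordered_semiring(3)
        norm_triangle_ineq norm_triangle_ineq4 order_trans)
  finally show "norm (F (u + x * s) + F (u + (1 - x) * s) - (2 / s) *\<^sub>R (\<Phi> (u + s) - \<Phi> u)) \<le>
      4 * (M * s)"
    using e[of x] e[of "1 - x"] e3 x by simp
qed

section \<open>Expansion at a nontrivial root of unity\<close>

lemma unit_Re_lt_1:
  fixes c :: complex
  assumes "norm c = 1" "c \<noteq> 1"
  shows "Re c < 1"
proof (rule ccontr)
  assume "\<not> Re c < 1"
  hence "Re c = 1" using complex_Re_le_cmod[of c] assms by simp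
  moreover from this have "Im c = 0" using assms cmod_power2[of c] by simp
  ultimately show False using assms by (simp add: complex_eq_iff)
qed

text \<open>Moving from \<open>c\<close> along its radius to \<open>c * r\<close> costs
  \<open>1 - r\<close>, which is itself at most the norm of \<open>1 - c * r\<close>; the triangle
  inequality thus loses only a factor 2. This keeps \<open>1 - c * exp (- v)\<close> uniformly away
  from 0.\<close>

lemma norm_one_minus_scaled_ge:
  fixes c :: complex
  assumes "norm c = 1" "0 \<le> r" "r \<le> 1"
  shows "norm (1 - c * of_real r) \<ge> norm (1 - c) / 2"
proof -
  have "norm (1 - c) \<le> norm (1 - c * of_real r) + norm (c * of_real r - c)"
    using norm_triangle_ineq[of "1 - c * of_real r" "c * of_real r - c"] by simp
  moreover have "norm (c * of_real r - c) = 1 - r"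
  proof -
    have "c * of_real r - c = - (c * of_real (1 - r))" by (simp add: algebra_simps)
    thus ?thesis using assms by (simp only: norm_minus_cancel norm_mult norm_of_real) simp
  qed
  moreover have "1 - r \<le> norm (1 - c * of_real r)"
    using norm_triangle_ineq2[of 1 "c * of_real r"] assms by (simp add: norm_mult)
  ultimately show ?thesis by simp
qed

context
  fixes c :: complex
  assumes c: "norm c = 1" "c \<noteq> 1"
begin

text \<open>Since \<open>Re c < 1\<close>, the real part of \<open>c * exp (- v)\<close> stays below
  1 even at \<open>v = 0\<close>. So \<open>lg c\<close> is smooth up to the endpoint 0, in contrast
  to the case \<open>c = 1\<close>.\<close>

lemma lg_arg_notin_nonpos:
  assumes "v \<ge> 0"
  shows "1 - c * exp (- complex_of_real v) \<notin> \<real>\<^sub>\<le>\<^sub>0" "1 - c * exp (- complex_of_real v) \<noteq> 0"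
proof -
  have e: "exp (- complex_of_real v) = of_real (exp (- v))" by (simp flip: exp_of_real)
  have "Re (c * exp (- complex_of_real v)) = Re c * exp (- v)" unfolding e by simp
  also have "\<dots> < 1"
  proof (cases "Re c \<le> 0")
    case True
    thus ?thesis by (smt (verit) exp_gt_zero mult_nonpos_nonneg)
  next
    case False
    hence "Re c * exp (- v) \<le> Re c * 1" using assms by (intro mult_left_mono) auto
    thus ?thesis using unit_Re_lt_1[OF c] by simp
  qed
  finally show "1 - c * exp (- complex_of_real v) \<notin> \<real>\<^sub>\<le>\<^sub>0"
    by (simp add: complex_nonpos_Reals_iff)
  thus "1 - c * exp (- complex_of_real v) \<noteq> 0" by auto
qed

lemma lg_has_vector_derivative:
  assumes "v \<ge> 0"
  shows "((\<lambda>v. lg c (of_real v)) has_vector_derivative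
    c * exp (- of_real v) / (1 - c * exp (- of_real v))) (at v)"
proof (rule has_vector_derivative_real_field)
  show "(lg c has_field_derivative c * exp (- of_real v) / (1 - c * exp (- of_real v)))
      (at (complex_of_real v))"
    unfolding lg_def using lg_arg_notin_nonpos[OF assms]
    by (auto intro!: derivative_eq_intros simp: field_simps)
qed

lemma lg_deriv_has_vector_derivative:
  assumes "v \<ge> 0"
  shows "((\<lambda>v. c * exp (- of_real v) / (1 - c * exp (- of_real v))) has_vector_derivative
    - (c * exp (- of_real v)) / (1 - c * exp (- of_real v))\<^sup>2) (at v)"
proof (rule has_vector_derivative_real_field)
  show "((\<lambda>v. c * exp (- v) / (1 - c * exp (- v))) has_field_derivative
       - (c * exp (- of_real v)) / (1 - c * exp (- of_real v))\<^sup>2) (at (complex_of_real v))"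
    using lg_arg_notin_nonpos[OF assms]
    by (auto intro!: derivative_eq_intros simp: field_simps power2_eq_square)
qed

text \<open>The factor \<open>exp (- v)\<close> is retained because it makes the errors of the
  successive cells a geometric series.\<close>

lemma norm_lg_deriv2_le:
  assumes "v \<ge> 0"
  shows "norm (- (c * exp (- of_real v)) / (1 - c * exp (- of_real v))\<^sup>2) \<le>
      4 / (norm (1 - c))\<^sup>2 * exp (- v)"
proof -
  have e: "exp (- complex_of_real v) = of_real (exp (- v))" by (simp flip: exp_of_real)
  have "(norm (1 - c) / 2)\<^sup>2 \<le> (norm (1 - c * exp (- of_real v)))\<^sup>2"
    unfolding e using assms c by (intro power_mono norm_one_minus_scaled_ge) auto
  hence "exp (- v) / (norm (1 - c * exp (- of_real v)))\<^sup>2 \<le> exp (- v) / (norm (1 - c) / 2)\<^sup>2"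
    using c lg_arg_notin_nonpos(2)[OF assms] by (intro divide_left_mono) (auto intro!: mult_pos_pos)
  thus ?thesis using c by (simp add: norm_mult norm_divide norm_power power_divide mult_ac)
qed

lemma lg_deriv_diff_le:
  fixes u v :: real
  assumes "u \<ge> 0" "u < v"
  shows "norm (c * exp (- of_real v) / (1 - c * exp (- of_real v)) - c * exp (- of_real u) / (1 -
      c * exp (- of_real u)))
    \<le> 4 / (norm (1 - c))\<^sup>2 * exp (- u) * (v - u)"
proof -
  let ?F1 = "\<lambda>v. c * exp (- of_real v) / (1 - c * exp (- of_real v))"
  let ?F2 = "\<lambda>v. - (c * exp (- of_real v)) / (1 - c * exp (- of_real v))\<^sup>2"
  have "\<exists>t\<in>{u<..<v}. norm (?F1 v - ?F1 u) \<le> norm ((v - u) *\<^sub>R ?F2 t)"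
  proof (rule mvt_general[of u v ?F1 "\<lambda>t h. h *\<^sub>R ?F2 t"])
    show "(?F1 has_derivative (\<lambda>h. h *\<^sub>R ?F2 t)) (at t)" if "u < t" "t < v" for t
      using lg_deriv_has_vector_derivative[of t] that assms by (simp add: has_vector_derivative_def)
    show "continuous_on {u..v} ?F1"
      using lg_arg_notin_nonpos(2) assms by (intro continuous_intros) auto
  qed (use assms in auto)
  then obtain t where t: "u < t" "t < v" "norm (?F1 v - ?F1 u) \<le> norm ((v - u) *\<^sub>R ?F2 t)" by auto
  note t(3)
  also have "norm ((v - u) *\<^sub>R ?F2 t) = (v - u) * norm (?F2 t)" using assms by simp
  also have "\<dots> \<le> (v - u) * (4 / (norm (1 - c))\<^sup>2 * exp (- t))"
    using assms t norm_lg_deriv2_le[of t] by (intro mult_left_mono) auto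
  also have "\<dots> \<le> (v - u) * (4 / (norm (1 - c))\<^sup>2 * exp (- u))"
    using assms t by (intro mult_left_mono) auto
  finally show ?thesis by (simp add: mult_ac)
qed

text \<open>The single-point Euler-Maclaurin estimate is summed over the cells
  \<open>[s k, s (k + 1)]\<close>. The differences of \<open>dilog\<close> and of \<open>lg\<close>
  telescope to minus their values at 0, which give the pole and the constant term; the errors, of
  size \<open>s\<^sup>2 * exp (- s k)\<close>, sum to \<open>O(s)\<close>.\<close>

lemma logprod_asymp_bound:
  assumes x: "0 < x" "x \<le> 1" and s: "s > 0"
  shows "norm (logprod c x (of_real s) + dilog c 0 / of_real s - of_real (1/2 - x) * Ln (1 - c))
    \<le> 12 / (norm (1 - c))\<^sup>2 * (s\<^sup>2 / (1 - exp (- s)))"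
proof -
  define F where "F = (\<lambda>v. lg c (of_real v))"
  define \<Phi> where "\<Phi> = (\<lambda>v. dilog c (of_real v))"
  define K where "K = 4 / (norm (1 - c))\<^sup>2"
  \<comment> \<open>The error of the cell \<open>k\<close>; the constant \<open>D\<close> of the
    cell estimate is taken to be the derivative of \<open>F\<close> at the left endpoint.\<close>
  define E where "E = (\<lambda>k::nat. F (s * k + x * s) - (1 / s) *\<^sub>R (\<Phi> (s * Suc k) - \<Phi> (s * k)) - (x -
      1/2) *\<^sub>R (F (s * Suc k) - F (s * k)))"
  have E_le: "norm (E k) \<le> (3 * K * s\<^sup>2) * exp (- s) ^ k" for k
  proof -
    define u where "u = s * k"
    have u: "u \<ge> 0" "s * Suc k = u + s" using s by (auto simp: u_def algebra_simps)
    have "norm (E k) \<le> 3 * (K * exp (- u) * s * s)"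
      unfolding E_def u(2) u_def[symmetric]
    proof (rule euler_maclaurin_cell_single)
      show "continuous_on {u..u + s} \<Phi>"
        unfolding \<Phi>_def using u c by (intro continuous_on_dilog_real) auto
      show "continuous_on {u..u + s} F"
        unfolding F_def using u
        by (intro continuous_at_imp_continuous_on ballI
              has_vector_derivative_continuous[OF lg_has_vector_derivative]) auto
      show "(\<Phi> has_vector_derivative F v) (at v)" if "u < v" for v
        unfolding F_def \<Phi>_def using u c that by (intro dilog_has_vector_derivative) auto
      show "(F has_vector_derivative c * exp (- of_real v) / (1 - c * exp (- of_real v))) (at v)"
          if "u < v" for v
        unfolding F_def using u that by (intro lg_has_vector_derivative) auto
      show "norm (c * exp (- of_real v) / (1 - c * exp (- of_real v)) - c * exp (- of_real u)
          / (1 - c * exp (- of_real u)))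
          \<le> K * exp (- u) * s" if "u < v" "v < u + s" for v
      proof -
        have "K * exp (- u) * (v - u) \<le> K * exp (- u) * s"
          using that by (intro mult_left_mono) (auto simp: K_def)
        with lg_deriv_diff_le[OF u(1) that(1)] show ?thesis unfolding K_def by linarith
      qed
    qed (use s x in auto)
    also have "exp (- u) = exp (- s) ^ k"
      by (simp add: u_def flip: exp_of_nat_mult)
    finally show ?thesis by (simp add: power2_eq_square mult_ac)
  qed
  have geo: "(\<lambda>k. (3 * K * s\<^sup>2) * exp (- s) ^ k) sums ((3 * K * s\<^sup>2) * (1 / (1 - exp (- s))))"
    using s by (intro sums_mult geometric_sums) auto
  have "filterlim (\<lambda>k. s * real k) at_top sequentially"
    using s by (intro filterlim_tendsto_pos_mult_at_top[OF tendsto_const]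
        filterlim_real_sequentially) auto
  hence "(\<lambda>k. \<Phi> (s * real k)) \<longlonglongrightarrow> 0"
    unfolding \<Phi>_def by (rule filterlim_compose[OF dilog_tendsto_0[OF c(1)]])
  hence \<Phi>: "(\<lambda>k. \<Phi> (s * real (Suc k)) - \<Phi> (s * real k)) sums (0 - \<Phi> (s * real 0))"
    by (rule telescope_sums)
  have "(\<lambda>n. lg c ((of_real 1 + of_nat n) * of_real s)) \<longlonglongrightarrow> 0"
    using c s by (intro summable_LIMSEQ_zero summable_logprod) auto
  hence "(\<lambda>n. F (s * real (Suc n))) \<longlonglongrightarrow> 0"
    by (simp add: F_def mult_ac)
  hence "(\<lambda>n. F (s * real n)) \<longlonglongrightarrow> 0" by (subst (asm) filterlim_sequentially_Suc)
  hence F: "(\<lambda>k. F (s * real (Suc k)) - F (s * real k)) sums (0 - F (s * real 0))"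
    by (rule telescope_sums)
  have "(\<lambda>k. lg c ((of_real x + of_nat k) * of_real s)) sums logprod c x (of_real s)"
    unfolding logprod_def using c s x by (intro summable_sums summable_logprod) auto
  hence "(\<lambda>k. F (s * real k + x * s)) sums logprod c x (of_real s)"
    by (simp add: F_def algebra_simps)
  from sums_diff[OF sums_diff[OF this sums_scaleR_right[OF \<Phi>, of "1 / s"]]
      sums_scaleR_right[OF F, of "x - 1/2"]]
  have "E sums (logprod c x (of_real s) + dilog c 0 / of_real s - of_real (1/2 - x) * Ln (1 - c))"
    unfolding E_def by (simp add: F_def \<Phi>_def lg_def scaleR_conv_of_real algebra_simps)
  hence "norm (logprod c x (of_real s) + dilog c 0 / of_real s - of_real (1/2 - x) * Ln (1 - c)) \<le>
      (\<Sum>k. (3 * K * s\<^sup>2) * exp (- s) ^ k)"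
    using norm_suminf_le[OF E_le sums_summable[OF geo]] by (simp add: sums_iff)
  also have "\<dots> = 12 / (norm (1 - c))\<^sup>2 * (s\<^sup>2 / (1 - exp (- s)))"
    using sums_unique[OF geo] by (simp add: K_def)
  finally show ?thesis .
qed

lemma logprod_asymp:
  assumes x: "0 < x" "x \<le> 1"
  shows "((\<lambda>s. logprod c x (of_real s) + dilog c 0 / of_real s) \<longlongrightarrow>
      of_real (1/2 - x) * Ln (1 - c)) (at_right 0)"
proof -
  have "((\<lambda>s. logprod c x (of_real s) + dilog c 0 / of_real s - of_real (1/2 - x) * Ln (1 - c)) \<longlongrightarrow>
      0) (at_right 0)"
  proof (rule Lim_null_comparison)
    show "\<forall>\<^sub>F s in at_right 0. norm (logprod c x (of_real s) + dilog c 0 / of_real s -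
        of_real (1/2 - x) * Ln (1 - c))
        \<le> 12 / (norm (1 - c))\<^sup>2 * (s * (1 + s))"
      using eventually_at_right_less[of 0]
    proof eventually_elim
      case (elim s)
      have "1 + s \<le> exp s" by (rule exp_ge_add_one_self)
      hence "s / (1 + s) \<le> 1 - exp (- s)" using elim by (simp add: exp_minus field_simps)
      hence "s\<^sup>2 / (1 - exp (- s)) \<le> s\<^sup>2 / (s / (1 + s))"
        using elim by (intro divide_left_mono) (auto intro!: mult_pos_pos)
      also have "\<dots> = s * (1 + s)" using elim by (simp add: power2_eq_square)
      finally have "12 / (norm (1 - c))\<^sup>2 * (s\<^sup>2 / (1 - exp (- s))) \<le>
          12 / (norm (1 - c))\<^sup>2 * (s * (1 + s))"
        by (intro mult_left_mono) auto
      with logprod_asymp_bound[OF x elim] show ?case by linarith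
    qed
    have "((\<lambda>s. 12 / (norm (1 - c))\<^sup>2 * (s * (1 + s))) \<longlongrightarrow>
        12 / (norm (1 - c))\<^sup>2 * (0 * (1 + 0))) (at_right 0)"
      by (intro tendsto_intros)
    thus "((\<lambda>s. 12 / (norm (1 - c))\<^sup>2 * (s * (1 + s))) \<longlongrightarrow> 0) (at_right 0)" by simp
  qed
  thus ?thesis by (simp add: LIM_zero_iff)
qed

end

section \<open>Expansion of a pair at the trivial root of unity\<close>

lemma lg_1_of_real:
  assumes "v > 0"
  shows "lg 1 (of_real v) = of_real (ln (1 - exp (- v)))"
proof -
  have "1 - 1 * exp (- complex_of_real v) = of_real (1 - exp (- v))"
    by (simp flip: exp_of_real)
  thus ?thesis using assms by (simp only: lg_def) (subst Ln_of_real, auto)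
qed

lemma ln_one_minus_exp_deriv:
  assumes "v > 0"
  shows "((\<lambda>v::real. ln (1 - exp (- v))) has_real_derivative 1 / (exp v - 1)) (at v)"
  using assms by (auto intro!: derivative_eq_intros simp: exp_minus field_simps)

lemma ln_one_minus_exp_deriv2:
  assumes "v > 0"
  shows "((\<lambda>v::real. 1 / (exp v - 1)) has_real_derivative - exp v / (exp v - 1)\<^sup>2) (at v)"
  using assms by (auto intro!: derivative_eq_intros simp: power2_eq_square)

text \<open>With \<open>w = exp v - 1\<close> the quotient is \<open>1 / w\<^sup>2 + 1 / w\<close>;
  the bounds \<open>w \<ge> v\<close> and \<open>w \<ge> v\<^sup>2 / 2\<close> turn this into
  \<open>1 / v\<^sup>2 + 2 / v\<^sup>2\<close>.\<close>

lemma ln_one_minus_exp_deriv2_le: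
  assumes "v > (0::real)"
  shows "\<bar>- exp v / (exp v - 1)\<^sup>2\<bar> \<le> 3 / v\<^sup>2"
proof -
  define w where "w = exp v - 1"
  have w: "w \<ge> v" "w \<ge> v\<^sup>2 / 2"
    using exp_lower_Taylor_quadratic[of v] exp_ge_add_one_self[of v] assms unfolding w_def
        by linarith+
  have "exp v / w\<^sup>2 = (1 + w) / w\<^sup>2" by (simp add: w_def)
  also have "\<dots> = 1 / w\<^sup>2 + 1 / w"
    using w assms by (simp add: add_divide_distrib power2_eq_square)
  also have "1 / w\<^sup>2 \<le> 1 / v\<^sup>2"
    using w assms by (intro divide_left_mono power_mono mult_pos_pos) auto
  also have "1 / w \<le> 1 / (v\<^sup>2 / 2)"
    using w assms by (intro divide_left_mono mult_pos_pos) auto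
  finally show ?thesis using assms by (simp add: w_def)
qed

lemma ln_one_minus_exp_deriv_diff_le:
  fixes u v :: real
  assumes "0 < u" "u < v"
  shows "\<bar>1 / (exp v - 1) - 1 / (exp u - 1)\<bar> \<le> 3 / u\<^sup>2 * (v - u)"
proof -
  obtain t where t: "u < t" "t < v" "1 / (exp v - 1) - 1 / (exp u - 1) =
      (v - u) * (- exp t / (exp t - 1)\<^sup>2)"
    using MVT2[of u v "\<lambda>v. 1 / (exp v - 1)" "\<lambda>v. - exp v / (exp v - 1)\<^sup>2"]
        assms ln_one_minus_exp_deriv2 by auto
  have "\<bar>(v - u) * (- exp t / (exp t - 1)\<^sup>2)\<bar> \<le> (v - u) * (3 / t\<^sup>2)"
    unfolding abs_mult using ln_one_minus_exp_deriv2_le[of t] assms t by (intro mult_mono) auto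
  also have "\<dots> \<le> (v - u) * (3 / u\<^sup>2)"
    using assms t by (intro mult_left_mono divide_left_mono power_mono mult_pos_pos) auto
  finally show ?thesis using t by (simp add: mult_ac)
qed

lemma ln_one_minus_exp_minus_ln: "((\<lambda>v::real. ln (1 - exp (- v)) - ln v) \<longlongrightarrow> 0) (at_right 0)"
  by real_asymp

text \<open>The endpoint 0 is included so that the primitive \<open>v * ln v - v\<close> of
  \<open>ln\<close> can be used on the cell \<open>k = 0\<close>.\<close>

lemma continuous_on_x_ln_x: "continuous_on {0..} (\<lambda>v::real. v * ln v)"
proof (rule continuous_on_eq_continuous_within[THEN iffD2], rule ballI)
  fix v :: real assume v: "v \<in> {0..}"
  show "continuous (at v within {0..}) (\<lambda>v. v * ln v)"
  proof (cases "v = 0")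
    case True
    have "((\<lambda>v::real. v * ln v) \<longlongrightarrow> 0) (at_right 0)" by real_asymp
    thus ?thesis unfolding True continuous_within by (simp add: at_within_Ici_at_right)
  next
    case False
    thus ?thesis using v by (intro continuous_intros) auto
  qed
qed

text \<open>The limit, as \<open>s\<close> tends to 0, of the midpoint-type error on \<open>[sk, s(k + 1)]\<close> of a pair of
  points \<open>s(k + x)\<close>, \<open>s(k + 1 - x)\<close> for the function \<open>ln (1 - exp (-v))\<close>, whose singularity at 0
  is that of \<open>ln v\<close>.  For \<open>k = 0\<close> the term \<open>k * ln k\<close> is 0, as it should be.\<close>

definition log_cell :: "real \<Rightarrow> nat \<Rightarrow> real" where
  "log_cell x k = ln (k + x) + ln (k + (1 - x)) - 2 * (Suc k * ln (Suc k) - k * ln k - 1)"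

text \<open>Tannery's theorem exchanges the sum over cells with the limit
  \<open>s \<rightarrow> 0\<close>: for \<open>k > 0\<close> the pair estimate dominates each cell
  error uniformly in \<open>s\<close>, and every single error converges to
  \<open>log_cell x k\<close> because \<open>ln (1 - exp (- v))\<close> differs from
  \<open>ln v\<close> by a function tending to 0. The primitives telescope to the pole term.\<close>

lemma summable_log_cell_and_asymp:
  assumes x: "0 < x" "x < 1"
  shows "summable (log_cell x)"
    and "((\<lambda>s. logprod 1 x (of_real s) + logprod 1 (1 - x) (of_real s) + 2 * dilog 1 0 / of_real s)
      \<longlongrightarrow> of_real (\<Sum>k. log_cell x k)) (at_right 0)"
proof -
  define F where "F = (\<lambda>v::real. ln (1 - exp (- v)))"
  define \<Phi> where "\<Phi> = (\<lambda>v. Re (dilog 1 (of_real v)))"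
  define E where "E = (\<lambda>k s. F (s * real k + x * s) + F (s * real k + (1 - x) * s) - (2 / s)
      *\<^sub>R (\<Phi> (s * real k + s) - \<Phi> (s * real k)))"
  have \<Phi>': "(\<Phi> has_real_derivative F v) (at v)" if "v > 0" for v
  proof -
    have "((\<lambda>v. dilog 1 (of_real v)) has_vector_derivative of_real (F v)) (at v)"
      using dilog_has_vector_derivative[of 1 v] that lg_1_of_real[OF that] by (simp add: F_def)
    from bounded_linear.has_vector_derivative[OF bounded_linear_Re this] show ?thesis
      by (simp add: \<Phi>_def has_real_derivative_iff_has_vector_derivative)
  qed
  have \<Phi>_cont: "continuous_on A \<Phi>" if "A \<subseteq> {0..}" for A
    unfolding \<Phi>_def by (intro continuous_intros continuous_on_dilog_real that) auto
  have F': "(F has_real_derivative 1 / (exp v - 1)) (at v)" if "v > 0" for v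
    unfolding F_def by (rule ln_one_minus_exp_deriv[OF that])

  \<comment> \<open>With \<open>u = s * k\<close> the cell estimate holds with
    \<open>M = 3 * s / u\<^sup>2\<close>, so all powers of \<open>s\<close> cancel in
    \<open>4 * M * s\<close>.\<close>
  have bound: "norm (E k s) \<le> 12 * (1 / real k ^ 2)" if "k > 0" "s > 0" for k s
  proof -
    define u where "u = s * real k"
    have u: "u > 0" using that by (simp add: u_def)
    have "norm (E k s) \<le> 4 * (3 / u\<^sup>2 * s * s)"
      unfolding E_def u_def[symmetric]
    proof (rule euler_maclaurin_cell_pair)
      show "continuous_on {u..u + s} \<Phi>" using u by (intro \<Phi>_cont) auto
      show "continuous_on {u..u + s} F"
        using u by (intro continuous_at_imp_continuous_on ballI DERIV_isCont[OF F']) auto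
      show "(\<Phi> has_vector_derivative F v) (at v)" if "u < v" for v
        using \<Phi>'[of v] that u by (simp add: has_real_derivative_iff_has_vector_derivative)
      show "(F has_vector_derivative 1 / (exp v - 1)) (at v)" if "u < v" for v
        using F'[of v] that u by (simp add: has_real_derivative_iff_has_vector_derivative)
      show "norm (1 / (exp v - 1) - 1 / (exp u - 1)) \<le> 3 / u\<^sup>2 * s" if "u < v" "v < u + s" for v
      proof -
        have "3 / u\<^sup>2 * (v - u) \<le> 3 / u\<^sup>2 * s" using that by (intro mult_left_mono) auto
        with ln_one_minus_exp_deriv_diff_le[OF u that(1)] show ?thesis by simp
      qed
    qed (use that x in auto)
    also have "4 * (3 / u\<^sup>2 * s * s) = 12 * (1 / real k ^ 2)"
      using that by (simp add: u_def power2_eq_square field_simps)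
    finally show ?thesis .
  qed

  \<comment> \<open>Splitting off \<open>ln v\<close>, whose cell errors can be computed exactly,
    leaves the harmless part \<open>G\<close> with primitive \<open>\<Psi>\<close>.\<close>
  define G where "G = (\<lambda>v. F v - ln v)"
  have G: "(G \<longlongrightarrow> 0) (at_right 0)"
    unfolding G_def F_def by (rule ln_one_minus_exp_minus_ln)
  have scale: "filterlim (\<lambda>s::real. s * r) (at_right 0) (at_right 0)" if "r > 0" for r
    using that by real_asymp
  define \<Psi> where "\<Psi> = (\<lambda>v. \<Phi> v - (v * ln v - v))"
  have \<Psi>': "(\<Psi> has_real_derivative G v) (at v)" if "v > 0" for v
    unfolding \<Psi>_def G_def using that by (auto intro!: derivative_eq_intros \<Phi>')
  have \<Psi>_lim: "((\<lambda>s. (1 / s) * (\<Psi> (s * real k + s) - \<Psi> (s * real k))) \<longlongrightarrow> 0) (at_right 0)" for k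
  proof (rule tendstoI)
    fix e :: real assume "e > 0"
    from tendstoD[OF G this] obtain d where d: "d > 0" "\<And>v. v > 0 \<Longrightarrow> v < d \<Longrightarrow> \<bar>G v\<bar> < e"
      by (auto simp: eventually_at_right_field dist_real_def)
    have "\<forall>\<^sub>F s in at_right (0::real). s * (real k + 1) < d"
    proof -
      have "((\<lambda>s. s * (real k + 1)) \<longlongrightarrow> 0 * (real k + 1)) (at_right 0)" by (intro tendsto_intros)
      thus ?thesis using d(1) by (intro order_tendstoD) auto
    qed
    thus "\<forall>\<^sub>F s in at_right 0. dist ((1 / s) * (\<Psi> (s * real k + s) - \<Psi> (s * real k))) 0 < e"
      using eventually_at_right_less[of 0]
    proof eventually_elim
      case (elim s)
      have "\<exists>l z. s * real k < z \<and> z < s * real k + s \<and> (\<Psi> has_real_derivative l) (at z) \<and>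
          \<Psi> (s * real k + s) - \<Psi> (s * real k) = (s * real k + s - s * real k) * l"
      \<comment> \<open>The scaled increment of \<open>\<Psi>\<close> is a value of \<open>G\<close>
        strictly inside the cell, hence at a positive point that tends to 0 with
        \<open>s\<close>.\<close>
      proof (rule MVT)
        show "continuous_on {s * real k..s * real k + s} \<Psi>"
          unfolding \<Psi>_def using elim
          by (intro continuous_intros \<Phi>_cont continuous_on_subset[OF continuous_on_x_ln_x])
              (auto intro: order_trans[rotated])
        show "\<Psi> differentiable (at v)" if "s * real k < v" for v
        proof -
          have "v > 0" using that elim by (smt (verit) mult_nonneg_nonneg of_nat_0_le_iff)
          thus ?thesis using \<Psi>' unfolding real_differentiable_def by blast
        qed
      qed (use elim in auto)
      then obtain l z where z: "s * real k < z" "z < s * real k + s" "(\<Psi> has_real_derivative l)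
          (at z)"
          "\<Psi> (s * real k + s) - \<Psi> (s * real k) = s * l" by auto
      have z0: "z > 0" using z elim by (smt (verit) mult_nonneg_nonneg of_nat_0_le_iff)
      from z(3) \<Psi>'[OF z0] have "l = G z" by (rule DERIV_unique)
      moreover have "z < d" using z elim by (simp add: algebra_simps)
      ultimately show ?case using d(2)[of z] z0 z(4) elim by (simp add: dist_real_def)
    qed
  qed
  have E_lim: "(E k \<longlongrightarrow> log_cell x k) (at_right 0)" for k
  proof (rule Lim_transform_eventually)
    have "((\<lambda>s. G (s * (k + x)) + G (s * (k + (1 - x))) - 2 * ((1 / s) * (\<Psi> (s * real k + s) -
        \<Psi> (s * real k))) + log_cell x k)
      \<longlongrightarrow> 0 + 0 - 2 * 0 + log_cell x k) (at_right 0)"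
      using x by (intro tendsto_intros \<Psi>_lim filterlim_compose[OF G] scale)
          (auto intro!: add_nonneg_pos)
    thus "((\<lambda>s. G (s * (k + x)) + G (s * (k + (1 - x))) - 2 * ((1 / s) * (\<Psi> (s * real k + s) -
        \<Psi> (s * real k))) + log_cell x k)
      \<longlongrightarrow> log_cell x k) (at_right 0)" by simp
    show "\<forall>\<^sub>F s in at_right 0. G (s * (k + x)) + G (s * (k + (1 - x))) - 2 * ((1 / s)
        * (\<Psi> (s * real k + s) - \<Psi> (s * real k))) + log_cell x k = E k s"
      using eventually_at_right_less[of 0]
    proof eventually_elim
      case (elim s)
      have kx: "k + x > 0" "k + (1 - x) > 0" using x by auto
      have 1: "ln (s * (k + x)) = ln s + ln (k + x)" "ln (s * (k + (1 - x))) =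
          ln s + ln (k + (1 - x))"
        using elim kx by (auto simp: ln_mult)
      have 2: "ln (s * real k + s) = ln s + ln (Suc k)"
        using elim ln_mult[of s "Suc k"] by (simp add: algebra_simps)
      have 3: "s * real k * ln (s * real k) = s * real k * (ln s + ln k)"
        using elim by (cases "k = 0") (auto simp: ln_mult)
      \<comment> \<open>The two evaluation points and the doubled mean over the cell each contribute
        \<open>2 * ln s\<close>; these cancel, and what is left of the \<open>ln\<close> part is
        \<open>log_cell x k\<close>.\<close>
      have "(1 / s) * (\<Psi> (s * real k + s) - \<Psi> (s * real k)) =
         (1 / s) * (\<Phi> (s * real k + s) - \<Phi> (s * real k)) - (ln s + (Suc k * ln (Suc k) -
           k * ln k - 1))"
        unfolding \<Psi>_def 2 3 using elim by (simp add: field_simps)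
      thus ?case
        unfolding E_def G_def log_cell_def 1 by (simp add: algebra_simps)
    qed
  qed
  have "summable (\<lambda>k. 12 * (1 / real k ^ 2))"
    using summable_inverse_Suc_squares by (intro summable_mult) (subst (asm) summable_Suc_iff)
  \<comment> \<open>The majorant is claimed for \<open>k > 0\<close> only: at \<open>k = 0\<close>
    the division by 0 makes it vanish.\<close>
  moreover have "\<forall>\<^sub>F (k, s) in at_top \<times>\<^sub>F at_right 0. norm (E k s) \<le> 12 * (1 / real k ^ 2)"
    using eventually_prodI[OF eventually_gt_at_top[of 0] eventually_at_right_less[of 0]]
    by eventually_elim (use bound in auto)
  ultimately have T: "summable (\<lambda>k. norm (log_cell x k))" "((\<lambda>s. \<Sum>k. E k s) \<longlongrightarrow>
      (\<Sum>k. log_cell x k)) (at_right 0)"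
    using tannerys_theorem[of E "log_cell x" "at_right 0" "\<lambda>k. 12 * (1 / real k ^ 2)"] E_lim by auto
  show "summable (log_cell x)" using T(1) by (rule summable_norm_cancel)

  have dilog0: "dilog 1 0 = of_real (Re (dilog 1 0))"
  proof -
    have "dilog 1 0 = of_real (\<Sum>n. 1 / real (Suc n) ^ 2)"
      unfolding dilog_def suminf_of_real[OF summable_inverse_Suc_squares] by simp
    thus ?thesis by simp
  qed
  have S: "(\<lambda>k. F (s * real k + x * s)) sums Re (logprod 1 x (of_real s)) \<and>
      Im (logprod 1 x (of_real s)) = 0"
    if "s > 0" "x > 0" for s x
  proof -
    have "(\<lambda>k. lg 1 ((of_real x + of_nat k) * of_real s)) sums logprod 1 x (of_real s)"
      unfolding logprod_def using that by (intro summable_sums summable_logprod) auto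
    moreover have "lg 1 ((of_real x + of_nat k) * of_real s) = of_real (F (s * real k + x * s))"
        for k
    proof -
      have "s * real k + x * s > 0" using that by (intro add_nonneg_pos) auto
      from lg_1_of_real[OF this] show ?thesis by (simp add: F_def algebra_simps)
    qed
    ultimately have "(\<lambda>k. of_real (F (s * real k + x * s))) sums logprod 1 x (of_real s)" by simp
    from sums_Re[OF this] sums_Im[OF this] show ?thesis
      by (auto simp: sums_iff)
  qed
  have "(\<Sum>k. E k s) = Re (logprod 1 x (of_real s)) + Re (logprod 1 (1 - x) (of_real s)) +
      2 * Re (dilog 1 0) / s" if "s > 0" for s
  proof -
    have "filterlim (\<lambda>k. s * real k) at_top sequentially"
      using that by (intro filterlim_tendsto_pos_mult_at_top[OF tendsto_const]
          filterlim_real_sequentially) auto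
    hence "(\<lambda>k. \<Phi> (s * real k)) \<longlonglongrightarrow> Re 0"
      unfolding \<Phi>_def by (intro tendsto_Re filterlim_compose[OF dilog_tendsto_0]) auto
    from telescope_sums[OF this]
    have \<Phi>: "(\<lambda>k. \<Phi> (s * real k + s) - \<Phi> (s * real k)) sums (0 - \<Phi> 0)"
      by (simp add: algebra_simps)
    from sums_diff[OF sums_add[OF conjunct1[OF S[OF that x(1)]] conjunct1[OF S[OF that, of "1 -
        x"]]] sums_scaleR_right[OF \<Phi>, of "2 / s"]]
    show ?thesis using x by (simp add: E_def sums_iff \<Phi>_def)
  qed
  hence eq: "of_real (\<Sum>k. E k s) = logprod 1 x (of_real s) + logprod 1 (1 - x) (of_real s) +
      2 * dilog 1 0 / of_real s" if "s > 0" for s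
    using S[OF that x(1)] S[OF that, of "1 - x"] dilog0 x that
    by (subst dilog0) (simp add: complex_eq_iff)
  show "((\<lambda>s. logprod 1 x (of_real s) + logprod 1 (1 - x) (of_real s) + 2 * dilog 1 0 / of_real s)
      \<longlongrightarrow> of_real (\<Sum>k. log_cell x k)) (at_right 0)"
  proof (rule Lim_transform_eventually[OF tendsto_of_real[OF T(2)]])
    show "\<forall>\<^sub>F s in at_right 0. of_real (\<Sum>k. E k s) =
        logprod 1 x (of_real s) + logprod 1 (1 - x) (of_real s) + 2 * dilog 1 0 / of_real s"
      using eventually_at_right_less[of 0] by eventually_elim (rule eq)
  qed
qed

section \<open>Evaluation of the constant by reflection and duplication\<close>

lemma rGamma_reflection_real: "rGamma x * rGamma (1 - x) = sin (pi * x) / (pi::real)"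
proof -
  have "complex_of_real (rGamma x * rGamma (1 - x)) = rGamma (of_real x) * rGamma (1 - of_real x)"
    by (simp flip: rGamma_complex_of_real)
  also have "\<dots> = of_real (sin (pi * x) / pi)"
    by (simp add: rGamma_reflection_complex sin_of_real flip: of_real_mult)
  finally show ?thesis by (simp only: of_real_eq_iff)
qed

text \<open>Subtracting the series at 1/2 removes the primitive terms, which do not depend on
  \<open>x\<close>. The partial sums become logarithms of quotients of Pochhammer symbols, that is,
  of approximants of \<open>1 / (Gamma x * Gamma (1 - x))\<close>, and the reflection formula gives
  the limit, with \<open>sin (pi / 2) = 1\<close> in the denominator.\<close>

lemma suminf_log_cell_diff:
  assumes x: "0 < x" "x < 1"
  shows "(\<Sum>k. log_cell x k) - (\<Sum>k. log_cell (1/2) k) = ln (sin (pi * x))"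
proof -
  have lim: "(\<lambda>n. rGamma_series x n * rGamma_series (1 - x) n) \<longlonglongrightarrow> sin (pi * x) / pi" for x :: real
    using tendsto_mult[OF rGamma_series_LIMSEQ[of x] rGamma_series_LIMSEQ[of "1 - x"]]
    by (simp only: rGamma_reflection_real)
  have sin_pos: "sin (pi * x) > 0" using x by (intro sin_gt_zero) auto
  have "(\<lambda>n. ln ((rGamma_series x n * rGamma_series (1 - x) n) / (rGamma_series (1/2)
      n * rGamma_series (1 - 1/2) n)))
      \<longlonglongrightarrow> ln ((sin (pi * x) / pi) / (sin (pi * (1/2)) / pi))"
    using sin_pos by (intro tendsto_intros lim) (auto simp: sin_pi_half)
  also have "(sin (pi * x) / pi) / (sin (pi * (1/2)) / pi) = sin (pi * x)" by simp
  finally have L: "(\<lambda>n. ln ((rGamma_series x n * rGamma_series (1 - x) n) / (rGamma_series (1/2)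
      n * rGamma_series (1 - 1/2) n)))
      \<longlonglongrightarrow> ln (sin (pi * x))" .
  have poch_pos: "pochhammer y n > 0" if "y > 0" for y :: real and n
    by (rule pochhammer_pos[OF that])
  have poch: "ln (pochhammer y n) = (\<Sum>k<n. ln (real k + y))" if "y > 0" for y :: real and n
  proof -
    have "y + real i \<noteq> 0" for i using that by linarith
    thus ?thesis
      by (simp add: pochhammer_prod atLeast0LessThan ln_prod add.commute)
  qed
  have "\<forall>\<^sub>F n in sequentially. ln ((rGamma_series x n * rGamma_series (1 - x) n)
      / (rGamma_series (1/2) n * rGamma_series (1 - 1/2) n))
     = (\<Sum>k<Suc n. log_cell x k - log_cell (1/2) k)"
    using eventually_gt_at_top[of 0]
  proof eventually_elim
    case (elim n)
    \<comment> \<open>The powers of \<open>n\<close> with exponents \<open>y\<close> and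
      \<open>1 - y\<close> multiply to \<open>n\<close>; the denominator is then independent of
      \<open>y\<close> and drops out of the quotient.\<close>
    have *: "rGamma_series y n * rGamma_series (1 - y) n =
        pochhammer y (Suc n) * pochhammer (1 - y) (Suc n) / ((fact n)\<^sup>2 * real n)" for y :: real
    proof -
      have "y * ln n + (1 - y) * ln n = ln n" by (simp add: algebra_simps)
      hence "exp (y * ln n) * exp ((1 - y) * ln n) = real n"
        unfolding exp_add[symmetric] using elim by simp
      moreover have "(P / (f * e)) * (P' / (f * e')) = P * P' / (f\<^sup>2 * (e * e'))"
          for P P' f e e' :: real
        by (simp add: power2_eq_square mult_ac)
      ultimately show ?thesis unfolding rGamma_series_def of_real_eq_id id_def
          by (simp only: Suc_eq_plus1)
    qed
    have "(fact n)\<^sup>2 * real n \<noteq> 0" using elim by simp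
    moreover have "(P / z) / (P' / z) = P / P'" if "z \<noteq> 0" for P P' z :: real
      using that by simp
    ultimately have "ln ((rGamma_series x n * rGamma_series (1 - x) n) / (rGamma_series (1/2)
        n * rGamma_series (1 - 1/2) n)) =
      ln ((pochhammer x (Suc n) * pochhammer (1 - x) (Suc n)) / (pochhammer (1/2) (Suc n)
          * pochhammer (1 - 1/2) (Suc n)))"
      unfolding * by presburger
    also have "\<dots> = (\<Sum>k<Suc n. ln (real k + x)) + (\<Sum>k<Suc n. ln (real k + (1 - x))) -
        ((\<Sum>k<Suc n. ln (real k + 1/2)) + (\<Sum>k<Suc n. ln (real k + (1 - 1/2))))"
    proof -
      have "ln ((A * B) / (C * D)) = ln A + ln B - (ln C + ln D)"
        if "A > 0" "B > 0" "C > 0" "D > 0" for A B C D :: real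
        using that by (simp add: ln_mult ln_div)
      from this[OF poch_pos poch_pos poch_pos poch_pos, of x "1 - x" "1/2" "1 - 1/2" "Suc n"
          "Suc n" "Suc n" "Suc n"]
      show ?thesis using x by (simp only: poch)
    qed
    also have "\<dots> = (\<Sum>k<Suc n. log_cell x k - log_cell (1/2) k)"
      unfolding sum.distrib[symmetric] sum_subtractf[symmetric] log_cell_def
      by (intro sum.cong refl) simp
    finally show ?case .
  qed
  from Lim_transform_eventually[OF L this]
  have "(\<lambda>k. log_cell x k - log_cell (1/2) k) sums ln (sin (pi * x))"
    unfolding sums_def by (subst (asm) filterlim_sequentially_Suc)
  moreover have "(\<lambda>k. log_cell x k - log_cell (1/2) k) sums ((\<Sum>k. log_cell x k) -
      (\<Sum>k. log_cell (1/2) k))"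
    using x by (intro sums_diff summable_sums summable_log_cell_and_asymp) auto
  ultimately show ?thesis by (simp add: sums_iff)
qed

text \<open>Separating even and odd indices: the points \<open>(1/2 + 2k) s\<close> and
  \<open>(3/2 + 2k) s\<close> are the points with offsets 1/4 and 3/4 at the scale
  \<open>2 s\<close>.\<close>

lemma logprod_1_duplication:
  assumes "s > 0"
  shows "logprod 1 (1/2) (of_real s) = logprod 1 (1/4) (of_real (s * 2)) + logprod 1 (1 - 1/4)
      (of_real (s * 2))"
proof -
  have "exp (of_nat 2 * complex_of_real s) = of_real (exp (real 2 * Re (of_real s)))"
    unfolding exp_of_real[symmetric] by simp
  from logprod_regroup[OF _ _ _ _ this, of 1 "1/2"] assms show ?thesis
    by (simp add: numeral_2_eq_2 mult_ac)
qed

text \<open>Stirling's formula is avoided: the duplication formula gives \<open>C(1/2) = 2 C(1/4)\<close> for the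
  constant terms, and the reflection formula gives \<open>C(1/4) - C(1/2)\<close>.\<close>

lemma suminf_log_cell_half: "(\<Sum>k. log_cell (1/2) k) = ln 2"
proof -
  define C where "C = (\<lambda>x. \<Sum>k. log_cell x k)"
  define Q where "Q = (\<lambda>x s. logprod 1 x (of_real s) + logprod 1 (1 - x) (of_real s) +
      2 * dilog 1 0 / of_real s)"
  have Q: "(Q x \<longlongrightarrow> of_real (C x)) (at_right 0)" if "0 < x" "x < 1" for x
    unfolding Q_def C_def by (rule summable_log_cell_and_asymp[OF that])
  have "filterlim (\<lambda>s::real. s * 2) (at_right 0) (at_right 0)" by real_asymp
  hence "((\<lambda>s. 2 * Q (1/4) (s * 2)) \<longlongrightarrow> 2 * of_real (C (1/4))) (at_right 0)"
    by (intro tendsto_intros filterlim_compose[OF Q]) auto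
  hence "(Q (1/2) \<longlongrightarrow> 2 * of_real (C (1/4))) (at_right 0)"
  proof (rule Lim_transform_eventually)
    show "\<forall>\<^sub>F s in at_right 0. 2 * Q (1/4) (s * 2) = Q (1/2) s"
      using eventually_at_right_less[of 0]
    proof eventually_elim
      case (elim s)
      \<comment> \<open>The pole terms match as well, since twice the pole at scale
        \<open>2 s\<close> is the pole at scale \<open>s\<close>.\<close>
      show ?case using logprod_1_duplication[OF elim] by (simp add: Q_def algebra_simps)
    qed
  qed
  moreover have "(Q (1/2) \<longlongrightarrow> of_real (C (1/2))) (at_right 0)" by (rule Q) auto
  ultimately have "2 * complex_of_real (C (1/4)) = of_real (C (1/2))"
    by (intro tendsto_unique[where F = "at_right 0"]) auto
  from arg_cong[OF this, of Re] have "C (1/2) = 2 * C (1/4)" by simp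
  moreover have "C (1/4) - C (1/2) = ln (sin (pi * (1/4)))"
    unfolding C_def by (rule suminf_log_cell_diff) auto
  moreover have "ln (sin (pi * (1/4))) = - ln 2 / 2"
    by (simp add: sin_45 ln_div ln_sqrt)
  ultimately show ?thesis unfolding C_def by simp
qed

lemma logprod_1_pair_asymp:
  assumes x: "0 < x" "x < 1"
  shows "((\<lambda>s. logprod 1 x (of_real s) + logprod 1 (1 - x) (of_real s) + 2 * dilog 1 0 / of_real s)
      \<longlongrightarrow> of_real (ln (2 * sin (pi * x)))) (at_right 0)"
proof -
  have "sin (pi * x) > 0" using x by (intro sin_gt_zero) auto
  hence "(\<Sum>k. log_cell x k) = ln (2 * sin (pi * x))"
    using suminf_log_cell_diff[OF x] suminf_log_cell_half by (simp add: ln_mult)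
  with summable_log_cell_and_asymp(2)[OF x] show ?thesis by simp
qed

section \<open>Integrals of logarithmic derivatives along vertical lines\<close>

lemma dlog_exp:
  assumes L: "L holomorphic_on {\<tau>. Im \<tau> > 0}"
    and U: "\<And>\<tau>. Im \<tau> > 0 \<Longrightarrow> U \<tau> = exp (L \<tau>)"
    and \<tau>: "Im \<tau> > 0"
  shows "dlog U \<tau> = deriv L \<tau>"
proof -
  have "(L has_field_derivative deriv L \<tau>) (at \<tau>)"
    using L \<tau> by (intro holomorphic_derivI[OF L open_halfspace_Im_gt]) auto
  hence "((\<lambda>\<tau>. exp (L \<tau>)) has_field_derivative exp (L \<tau>) * deriv L \<tau>) (at \<tau>)"
    by (auto intro!: derivative_eq_intros)
  hence "(U has_field_derivative exp (L \<tau>) * deriv L \<tau>) (at \<tau>)"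
    by (rule has_field_derivative_transform_within_open[OF _ open_halfspace_Im_gt[of 0]])
       (use U \<tau> in auto)
  thus ?thesis using U[OF \<tau>] by (simp add: dlog_def DERIV_imp_deriv)
qed

text \<open>Cauchy's estimate on the disc of radius \<open>h\<close>: the disc stays where the bound
  on \<open>L\<close> holds, and lowering the imaginary part by at most \<open>h\<close> costs the
  factor \<open>exp (p * h)\<close>.\<close>

lemma deriv_exp_decay:
  assumes L: "L holomorphic_on {\<tau>. Im \<tau> > 0}" and h: "h > 0"
    and bd: "\<And>\<tau>. Im \<tau> \<ge> h \<Longrightarrow> norm (L \<tau>) \<le> K * exp (- p * Im \<tau>)" and p: "p > 0" and \<tau>: "Im \<tau> \<ge> 2 * h"
  shows "norm (deriv L \<tau>) \<le> K * exp (p * h) / h * exp (- p * Im \<tau>)"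
proof -
  have K: "K \<ge> 0"
    using order_trans[OF norm_ge_zero bd[of \<tau>]] \<tau> h by (simp add: zero_le_mult_iff)
  have Im_ge: "Im z \<ge> Im \<tau> - h" if "norm (\<tau> - z) \<le> h" for z
    using abs_Im_le_cmod[of "\<tau> - z"] that by simp
  have sub: "cball \<tau> h \<subseteq> {\<tau>. Im \<tau> > 0}"
    using Im_ge \<tau> h by (fastforce simp: dist_norm)
  have "norm ((deriv ^^ 1) L \<tau>) \<le> fact 1 * (K * exp (- p * (Im \<tau> - h))) / h ^ 1"
  proof (rule Cauchy_inequality)
    show "L holomorphic_on ball \<tau> h"
      by (rule holomorphic_on_subset[OF L]) (use sub ball_subset_cball in blast)
    show "continuous_on (cball \<tau> h) L"
      by (rule holomorphic_on_imp_continuous_on[OF holomorphic_on_subset[OF L sub]])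
    fix z assume z: "norm (\<tau> - z) = h"
    have "norm (L z) \<le> K * exp (- p * Im z)" using Im_ge[of z] z \<tau> by (intro bd) auto
    also have "\<dots> \<le> K * exp (- p * (Im \<tau> - h))"
      using Im_ge[of z] z K p by (intro mult_left_mono) auto
    finally show "norm (L z) \<le> K * exp (- p * (Im \<tau> - h))" .
  qed (use h in auto)
  also have "exp (- p * (Im \<tau> - h)) = exp (p * h) * exp (- p * Im \<tau>)"
    by (simp add: algebra_simps flip: exp_add)
  finally show ?thesis by (simp add: mult_ac)
qed

text \<open>Along the path \<open>dlog U\<close> is the derivative of \<open>L\<close>. Its decay
  gives absolute integrability, so the integral is the limit of those over
  \<open>{\<epsilon>..b}\<close>; the contribution of the upper end vanishes because
  \<open>L\<close> decays.\<close>

lemma integral_dlog_vertical: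
  assumes L: "L holomorphic_on {\<tau>. Im \<tau> > 0}"
    and U: "\<And>\<tau>. Im \<tau> > 0 \<Longrightarrow> U \<tau> = exp (L \<tau>)"
    and p: "p > 0"
    and bd: "\<And>h. h > 0 \<Longrightarrow> \<exists>K. \<forall>\<tau>. Im \<tau> \<ge> h \<longrightarrow> norm (L \<tau>) \<le> K * exp (- p * Im \<tau>)"
    and \<epsilon>: "\<epsilon> > 0"
  shows "vertical_pullback (dlog U) r absolutely_integrable_on {\<epsilon>..}"
    and "integral {\<epsilon>..} (vertical_pullback (dlog U) r) = - L (of_real r + \<i> * of_real \<epsilon>)"
proof -
  define \<phi> where "\<phi> = vertical_pullback (dlog U) r"
  define \<psi> where "\<psi> = (\<lambda>t. L (of_real r + \<i> * of_real t))"
  \<comment> \<open>Half the height leaves room for Cauchy discs of radius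
    \<open>\<epsilon> / 2\<close> around the points of the path above
    \<open>\<epsilon>\<close>.\<close>
  obtain K where K: "\<And>\<tau>. Im \<tau> \<ge> \<epsilon> / 2 \<Longrightarrow> norm (L \<tau>) \<le> K * exp (- p * Im \<tau>)"
    using bd[of "\<epsilon> / 2"] \<epsilon> by auto
  have \<phi>_eq: "\<phi> t = deriv L (of_real r + \<i> * of_real t) * \<i>" if "t > 0" for t
    unfolding \<phi>_def vertical_pullback_def using dlog_exp[OF L U] that by simp
  have cont: "continuous_on {\<epsilon>..} \<phi>"
  proof (rule continuous_on_eq)
    have "deriv L holomorphic_on {\<tau>. Im \<tau> > 0}"
      using L open_halfspace_Im_gt by (rule holomorphic_deriv)
    hence "continuous_on {\<tau>. Im \<tau> > 0} (deriv L)" by (rule holomorphic_on_imp_continuous_on)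
    hence "continuous_on {\<epsilon>..} (\<lambda>t. deriv L (of_real r + \<i> * of_real t))"
      by (rule continuous_on_compose2) (use \<epsilon> in \<open>auto intro!: continuous_intros\<close>)
    thus "continuous_on {\<epsilon>..} (\<lambda>t. deriv L (of_real r + \<i> * of_real t) * \<i>)"
      by (rule continuous_on_mult_right)
    show "deriv L (of_real r + \<i> * of_real t) * \<i> = \<phi> t" if "t \<in> {\<epsilon>..}" for t
      using \<phi>_eq[of t] that \<epsilon> by simp
  qed
  have \<psi>': "(\<psi> has_vector_derivative \<phi> t) (at t)" if "t > 0" for t
  proof -
    have "(L has_field_derivative deriv L (of_real r + \<i> * of_real t)) (at (of_real r +
        \<i> * of_real t))"
      using that by (intro holomorphic_derivI[OF L open_halfspace_Im_gt]) auto
    moreover have "((\<lambda>t. of_real r + \<i> * of_real t) has_vector_derivative \<i>) (at t)"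
      by (auto intro!: derivative_eq_intros)
    ultimately have "(L \<circ> (\<lambda>t. of_real r + \<i> * of_real t)
        has_vector_derivative \<i> * deriv L (of_real r + \<i> * of_real t)) (at t)"
      by (rule field_vector_diff_chain_at[rotated])
    thus ?thesis using \<phi>_eq[OF that] by (simp add: \<psi>_def o_def mult.commute)
  qed
  have abs: "\<phi> absolutely_integrable_on {\<epsilon>..}"
  proof (rule measurable_bounded_by_integrable_imp_absolutely_integrable)
    show "\<phi> \<in> borel_measurable (lebesgue_on {\<epsilon>..})"
      by (intro continuous_imp_measurable_on_sets_lebesgue cont) auto
    show "(\<lambda>t. K * exp (p * (\<epsilon> / 2)) / (\<epsilon> / 2) * exp (- p * t)) integrable_on {\<epsilon>..}"
      using p by (intro integrable_on_mult_right integrable_on_exp_minus_to_infinity)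
    show "norm (\<phi> t) \<le> K * exp (p * (\<epsilon> / 2)) / (\<epsilon> / 2) * exp (- p * t)" if "t \<in> {\<epsilon>..}" for t
      using deriv_exp_decay[where \<tau> = "of_real r + \<i> * of_real t" and h =
          "\<epsilon> / 2", OF L _ K p] \<phi>_eq[of t] that \<epsilon>
      by (simp add: norm_mult)
  qed auto
  have "((\<lambda>b. set_lebesgue_integral lebesgue {\<epsilon>..b} \<phi>) \<longlongrightarrow>
      set_lebesgue_integral lebesgue {\<epsilon>..} \<phi>) at_top"
    by (rule tendsto_set_lebesgue_integral_at_top[OF _ abs]) auto
  hence "((\<lambda>b. set_lebesgue_integral lebesgue {\<epsilon>..b} \<phi>) \<longlongrightarrow> integral {\<epsilon>..} \<phi>) at_top"
    using set_lebesgue_integral_eq_integral(2)[OF abs] by simp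
  moreover have "\<forall>\<^sub>F b in at_top. set_lebesgue_integral lebesgue {\<epsilon>..b} \<phi> = \<psi> b - \<psi> \<epsilon>"
    using eventually_ge_at_top[of \<epsilon>]
  proof eventually_elim
    case (elim b)
    have "\<phi> absolutely_integrable_on {\<epsilon>..b}"
      by (rule set_integrable_subset[OF abs]) auto
    hence "set_lebesgue_integral lebesgue {\<epsilon>..b} \<phi> = integral {\<epsilon>..b} \<phi>"
      by (rule set_lebesgue_integral_eq_integral)
    also have "(\<phi> has_integral (\<psi> b - \<psi> \<epsilon>)) {\<epsilon>..b}"
      using elim \<psi>' \<epsilon> by (intro fundamental_theorem_of_calculus)
          (auto intro: has_vector_derivative_at_within)
    hence "integral {\<epsilon>..b} \<phi> = \<psi> b - \<psi> \<epsilon>" by (rule integral_unique)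
    finally show ?case .
  qed
  ultimately have "((\<lambda>b. \<psi> b - \<psi> \<epsilon>) \<longlongrightarrow> integral {\<epsilon>..} \<phi>) at_top"
    by (rule Lim_transform_eventually)
  moreover have "(\<psi> \<longlongrightarrow> 0) at_top"
  proof (rule Lim_null_comparison)
    show "\<forall>\<^sub>F t in at_top. norm (\<psi> t) \<le> K * exp (- p * t)"
      using eventually_ge_at_top[of \<epsilon>]
    proof eventually_elim
      case (elim t)
      show ?case unfolding \<psi>_def using K[of "of_real r + \<i> * of_real t"] elim \<epsilon> by simp
    qed
    show "((\<lambda>t. K * exp (- p * t)) \<longlongrightarrow> 0) at_top"
      using p by real_asymp
  qed
  hence "((\<lambda>b. \<psi> b - \<psi> \<epsilon>) \<longlongrightarrow> 0 - \<psi> \<epsilon>) at_top" by (intro tendsto_intros)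
  ultimately have "integral {\<epsilon>..} \<phi> = 0 - \<psi> \<epsilon>"
    by (rule tendsto_unique[OF trivial_limit_at_top_linorder])
  thus "integral {\<epsilon>..} (vertical_pullback (dlog U) r) = - L (of_real r + \<i> * of_real \<epsilon>)"
    by (simp add: \<psi>_def \<phi>_def)
  show "vertical_pullback (dlog U) r absolutely_integrable_on {\<epsilon>..}"
    using abs by (simp only: \<phi>_def)
qed

text \<open>The only counterterm is the one with exponent 1 and coefficient \<open>A\<close>; there
  is no logarithmic one. The sign of the limit flips because the integral equals
  \<open>- L\<close>.\<close>

lemma has_fp_integral_simple_pole:
  assumes L: "L holomorphic_on {\<tau>. Im \<tau> > 0}"
    and U: "\<And>\<tau>. Im \<tau> > 0 \<Longrightarrow> U \<tau> = exp (L \<tau>)"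
    and p: "p > 0"
    and bd: "\<And>h. h > 0 \<Longrightarrow> \<exists>K. \<forall>\<tau>. Im \<tau> \<ge> h \<longrightarrow> norm (L \<tau>) \<le> K * exp (- p * Im \<tau>)"
    and lim: "((\<lambda>t. L (of_real r + \<i> * of_real t) + A / of_real t) \<longlongrightarrow> M) (at_right 0)"
  shows "has_fp_integral (vertical_pullback (dlog U) r) (- M)"
proof -
  note I = integral_dlog_vertical[OF L U p bd]
  have "((\<lambda>\<epsilon>. integral {\<epsilon>..} (vertical_pullback (dlog U) r) -
              ((\<Sum>s\<in>{1}. A * of_real (\<epsilon> powr (-s))) + 0 * of_real (ln \<epsilon>))) \<longlongrightarrow> - M) (at_right 0)"
  proof (rule Lim_transform_eventually[OF tendsto_minus[OF lim]])
    show "\<forall>\<^sub>F \<epsilon> in at_right 0. - (L (of_real r + \<i> * of_real \<epsilon>) + A / of_real \<epsilon>) =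
       integral {\<epsilon>..} (vertical_pullback (dlog U) r) -
              ((\<Sum>s\<in>{1}. A * of_real (\<epsilon> powr (-s))) + 0 * of_real (ln \<epsilon>))"
      using eventually_at_right_less[of 0]
    proof eventually_elim
      case (elim \<epsilon>)
      show ?case using I(2)[OF _ _ elim, of r] elim by (simp add: powr_minus divide_inverse)
    qed
  qed
  thus ?thesis unfolding has_fp_integral_def using I(1)
    by (intro conjI allI impI exI[of _ "{1::real}"] exI[of _ "\<lambda>_. A"] exI[of _ 0]) auto
qed

section \<open>The logarithm of \<open>u(f)\<close>\<close>

lemma complex_of_real_of_rat: "complex_of_real (of_rat q) = of_rat q"
  by (induct q) (simp add: of_rat_rat)

lemma zpow_eq_cis: "zpow q = cis (2 * pi * of_rat q)"
  by (simp add: zpow_def cis_conv_exp complex_of_real_of_rat mult_ac)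

lemma norm_zpow [simp]: "norm (zpow q) = 1"
  by (simp add: zpow_eq_cis)

lemma zpow_add: "zpow (q + r) = zpow q * zpow r"
  by (simp add: zpow_def of_rat_add ring_distribs exp_add)

lemma zpow_Ints:
  assumes "q \<in> \<int>"
  shows "zpow q = 1"
  using zpow_cong[of q 0] assms by (simp add: zpow_def)

lemma zpow_frac: "zpow q = zpow (frac q)"
  by (rule zpow_cong) (simp add: frac_def)

lemma one_minus_cis: "1 - cis (2 * t) = of_real (2 * sin t) * cis (t - pi / 2)"
  by (simp add: complex_eq_iff cos_double_sin sin_double cos_diff sin_diff power2_eq_square)

lemma B1_eq_frac: "q \<notin> \<int> \<Longrightarrow> B1 q = frac q - 1 / 2"
  by (simp add: B1_def frac_def)

lemma B1_add_Ints:
  assumes "k \<in> \<int>"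
  shows "B1 (q + k) = B1 q"
proof -
  obtain m where "k = of_int m" using assms by (auto elim: Ints_cases)
  thus ?thesis by (simp add: B1_def)
qed

lemma norm_one_minus_zpow: "norm (1 - zpow q) = \<bar>2 * sin (pi * of_rat q)\<bar>"
  using one_minus_cis[of "pi * of_rat q"] by (simp add: zpow_eq_cis norm_mult mult_ac)

lemma sin_pi_frac_pos:
  assumes "q \<notin> \<int>"
  shows "sin (pi * of_rat (frac q)) > 0"
proof -
  have "0 < frac q" "frac q < 1"
    using assms by (auto simp: frac_lt_1)
  hence "0 < real_of_rat (frac q)" "real_of_rat (frac q) < 1"
    by (simp_all add: of_rat_less_1_iff)
  thus ?thesis by (intro sin_gt_zero) auto
qed

lemma zpow_ne_1:
  assumes "q \<notin> \<int>"
  shows "zpow q \<noteq> 1"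
proof
  assume "zpow q = 1"
  hence "norm (1 - zpow (frac q)) = 0" using zpow_frac[of q] by simp
  thus False unfolding norm_one_minus_zpow using sin_pi_frac_pos[OF assms] by simp
qed

text \<open>With \<open>t = pi * frac q\<close> in (0, pi), \<open>1 - exp (2 i t)\<close> has
  modulus \<open>2 * sin t\<close> and argument \<open>t - pi / 2\<close>, which equals
  \<open>pi * B1 q\<close> and lies in the principal range.\<close>

lemma Ln_one_minus_zpow:
  assumes "q \<notin> \<int>"
  shows "Ln (1 - zpow q) = of_real (ln (norm (1 - zpow q))) + \<i> * of_real pi * of_rat (B1 q)"
proof -
  define t where "t = pi * of_rat (frac q)"
  have fr: "0 < frac q" "frac q < 1"
    using assms by (auto simp: frac_lt_1)
  hence fr': "0 < real_of_rat (frac q)" "real_of_rat (frac q) < 1"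
    by (simp_all add: of_rat_less_1_iff)
  have t: "0 < t" "t < pi" using fr' by (auto simp: t_def)
  have sin: "sin t > 0" using t by (rule sin_gt_zero)
  have eq: "1 - zpow q = of_real (2 * sin t) * cis (t - pi / 2)"
    using one_minus_cis[of t] zpow_frac[of q] by (simp add: zpow_eq_cis t_def mult_ac)
  have norm: "norm (1 - zpow q) = 2 * sin t"
    unfolding eq using sin by (simp add: norm_mult)
  have "1 - zpow q = exp (of_real (ln (2 * sin t)) + \<i> * of_real (t - pi / 2))"
    unfolding eq exp_add cis_conv_exp exp_of_real using sin by simp
  hence "Ln (1 - zpow q) = of_real (ln (2 * sin t)) + \<i> * of_real (t - pi / 2)"
    using t by (simp only:) (rule Ln_exp, auto)
  moreover have "complex_of_real (t - pi / 2) = of_real pi * of_rat (B1 q)"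
    using assms
        by (simp add: t_def B1_eq_frac of_rat_diff of_rat_divide complex_of_real_of_rat
            algebra_simps)
  ultimately show ?thesis unfolding norm by (simp add: mult.assoc)
qed

lemma B1_minus: "B1 (- q) = - B1 q"
proof (cases "q \<in> \<int>")
  case False
  hence "- q \<notin> \<int>" by (metis Ints_minus minus_minus)
  with False show ?thesis by (simp add: B1_eq_frac frac_neg)
qed (simp add: B1_def)

lemma norm_one_minus_zpow_minus: "norm (1 - zpow (- q)) = norm (1 - zpow q)"
  by (simp add: norm_one_minus_zpow of_rat_minus)

text \<open>For \<open>q \<notin> \<int>\<close> the logarithms at \<open>q\<close> and
  \<open>- q\<close> are conjugate and carry opposite coefficients \<open>1/2 - x\<close> and
  \<open>x - 1/2\<close>: the real parts cancel and the imaginary parts double. For integral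
  \<open>q\<close> the sine term takes over and \<open>B1 q = 0\<close>.\<close>

lemma logprod_pair_asymp:
  assumes x: "0 < x" "x < 1"
  shows "((\<lambda>s. logprod (zpow q) x (of_real s) + logprod (zpow (- q)) (1 - x) (of_real s)
           + (dilog (zpow q) 0 + dilog (zpow (- q)) 0) / of_real s) \<longlongrightarrow>
     of_real (if q \<in> \<int> then ln (2 * sin (pi * x)) else 0)
       - 2 * of_real pi * \<i> * of_real (x - 1/2) * of_rat (B1 q)) (at_right 0)"
proof (cases "q \<in> \<int>")
  case True
  hence "zpow q = 1" "zpow (- q) = 1" "B1 q = 0"
    by (auto simp: zpow_Ints B1_def)
  with logprod_1_pair_asymp[OF x] True show ?thesis by simp
next
  case False
  hence q': "- q \<notin> \<int>" by (metis Ints_minus minus_minus)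
  have x': "0 < 1 - x" "1 - x \<le> 1" using x by auto
  have "((\<lambda>s. (logprod (zpow q) x (of_real s) + dilog (zpow q) 0 / of_real s) +
      (logprod (zpow (- q)) (1 - x) (of_real s) + dilog (zpow (- q)) 0 / of_real s))
     \<longlongrightarrow> of_real (1/2 - x) * Ln (1 - zpow q) + of_real (1/2 - (1 - x)) * Ln (1 - zpow (- q)))
         (at_right 0)"
    by (intro tendsto_add logprod_asymp zpow_ne_1 False q' norm_zpow x x' less_imp_le)
  also have "of_real (1/2 - x) * Ln (1 - zpow q) + of_real (1/2 - (1 - x)) * Ln (1 - zpow (- q)) =
     of_real (if q \<in> \<int> then ln (2 * sin (pi * x)) else 0)
       - 2 * of_real pi * \<i> * of_real (x - 1/2) * of_rat (B1 q)"
    unfolding Ln_one_minus_zpow[OF False] Ln_one_minus_zpow[OF q']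
        norm_one_minus_zpow_minus B1_minus
    using False by (simp add: of_rat_minus algebra_simps)
  finally show ?thesis by (simp add: add_divide_distrib add_ac)
qed

text \<open>Both offsets are 1, so both coefficients are \<open>-1/2\<close>; now the imaginary
  parts cancel and the real parts add up.\<close>

lemma logprod_integer_pair_asymp:
  assumes "q \<notin> \<int>"
  shows "((\<lambda>s. logprod (zpow q) 1 (of_real s) + logprod (zpow (- q)) 1 (of_real s)
           + (dilog (zpow q) 0 + dilog (zpow (- q)) 0) / of_real s) \<longlongrightarrow>
     - of_real (ln (norm (1 - zpow q)))) (at_right 0)"
proof -
  have q': "- q \<notin> \<int>" using assms by (metis Ints_minus minus_minus)
  have "((\<lambda>s. (logprod (zpow q) 1 (of_real s) + dilog (zpow q) 0 / of_real s) +
      (logprod (zpow (- q)) 1 (of_real s) + dilog (zpow (- q)) 0 / of_real s))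
     \<longlongrightarrow> of_real (1/2 - 1) * Ln (1 - zpow q) + of_real (1/2 - 1) * Ln (1 - zpow (- q))) (at_right 0)"
    by (intro tendsto_add logprod_asymp zpow_ne_1 assms q' norm_zpow) auto
  also have "of_real (1/2 - 1) * Ln (1 - zpow q) + of_real (1/2 - 1) * Ln (1 - zpow (- q)) =
     - of_real (ln (norm (1 - zpow q)))"
    unfolding Ln_one_minus_zpow[OF assms] Ln_one_minus_zpow[OF q']
        norm_one_minus_zpow_minus B1_minus
    by (simp add: of_rat_minus algebra_simps)
  finally show ?thesis by (simp add: add_divide_distrib add_ac)
qed

section \<open>The holomorphic logarithm of \<open>u_prod\<close>\<close>

definition log_u :: "rat \<Rightarrow> rat \<Rightarrow> complex \<Rightarrow> complex" where
  "log_u a b \<tau> = logprod (zpow b) (of_rat (pos_rep a)) (- (2 * of_real pi * \<i> * \<tau>)) +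
     logprod (zpow (- b)) (of_rat (pos_rep (- a))) (- (2 * of_real pi * \<i> * \<tau>))"

lemma pos_rep_pos: "pos_rep a > 0" and pos_rep_le_1: "pos_rep a \<le> 1"
  unfolding pos_rep_def by linarith+

lemma of_rat_pos_rep_pos: "real_of_rat (pos_rep a) > 0"
  using pos_rep_pos by simp

lemma u_prod_eq_exp:
  assumes "Im \<tau> > 0"
  shows "u_prod a b \<tau> = exp (log_u a b \<tau>)"
proof -
  have "(\<Prod>n. 1 - qpow (pos_rep a + of_nat n) \<tau> * zpow b) =
     exp (logprod (zpow b) (of_rat (pos_rep a)) (- (2 * of_real pi * \<i> * \<tau>)))" for a b
  proof -
    have eq: "zpow b * exp (- ((of_real (of_rat (pos_rep a)) + of_nat n)
        * (- (2 * of_real pi * \<i> * \<tau>)))) =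
       qpow (pos_rep a + of_nat n) \<tau> * zpow b" for n
      by (simp add: qpow_def of_rat_add complex_of_real_of_rat mult_ac)
    have "exp (logprod (zpow b) (of_rat (pos_rep a)) (- (2 * of_real pi * \<i> * \<tau>))) =
      (\<Prod>n. 1 - zpow b * exp (- ((of_real (of_rat (pos_rep a)) + of_nat n)
        * (- (2 * of_real pi * \<i> * \<tau>)))))"
      using assms by (intro exp_logprod norm_zpow of_rat_pos_rep_pos) simp
    thus ?thesis by (simp only: eq)
  qed
  thus ?thesis by (simp add: u_prod_def log_u_def exp_add)
qed

lemma holomorphic_log_u: "log_u a b holomorphic_on {\<tau>. Im \<tau> > 0}"
proof -
  have "(\<lambda>\<tau>. logprod (zpow b) (of_rat (pos_rep a)) (- (2 * of_real pi * \<i> * \<tau>)))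
      holomorphic_on {\<tau>. Im \<tau> > 0}" for a b
  proof -
    have "logprod (zpow b) (of_rat (pos_rep a)) \<circ> (\<lambda>\<tau>. - (2 * of_real pi * \<i> * \<tau>))
        holomorphic_on {\<tau>. Im \<tau> > 0}"
      by (rule holomorphic_on_compose_gen[OF _ holomorphic_logprod[OF norm_zpow
          of_rat_pos_rep_pos]])
         (auto intro!: holomorphic_intros)
    thus ?thesis by (simp only: o_def)
  qed
  thus ?thesis unfolding log_u_def[abs_def] by (intro holomorphic_intros)
qed

text \<open>The rate \<open>p\<close> is 2 pi times the smallest exponent of q that occurs in the
  two products.\<close>

lemma log_u_decay:
  fixes a b :: rat
  defines "p \<equiv> 2 * pi * min (of_rat (pos_rep a)) (of_rat (pos_rep (- a)))"
  assumes h: "h > 0"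
  shows "\<exists>K. \<forall>\<tau>. Im \<tau> \<ge> h \<longrightarrow> norm (log_u a b \<tau>) \<le> K * exp (- p * Im \<tau>)"
proof -
  have *: "\<exists>K\<ge>0. \<forall>\<tau>. Im \<tau> \<ge> h \<longrightarrow> norm (logprod (zpow b) (of_rat (pos_rep a))
      (- (2 * of_real pi * \<i> * \<tau>))) \<le>
     K * exp (- (2 * pi * of_rat (pos_rep a)) * Im \<tau>)" for a b
  proof -
    define x where "x = real_of_rat (pos_rep a)"
    have x: "x > 0" unfolding x_def by (rule of_rat_pos_rep_pos)
    define k where "k = 2 * pi * h"
    have k: "k > 0" using h by (simp add: k_def)
    define K where "K = exp (- x * k) / (1 - exp (- x * k)) / (1 - exp (- k))"
    have "K \<ge> 0" using x k by (simp add: K_def)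
    have "norm (logprod (zpow b) x (- (2 * of_real pi * \<i> * \<tau>))) \<le>
        (exp (x * k) * K) * exp (- (2 * pi * x) * Im \<tau>)"
      if "Im \<tau> \<ge> h" for \<tau>
    proof -
      have "norm (logprod (zpow b) x (- (2 * of_real pi * \<i> * \<tau>))) \<le>
          exp (- x * (2 * pi * Im \<tau> - k)) * K"
        using norm_logprod_le[of "zpow b" x k "- (2 * of_real pi * \<i> * \<tau>)"] x k that
            by (simp add: K_def k_def)
      also have "exp (- x * (2 * pi * Im \<tau> - k)) = exp (x * k) * exp (- (2 * pi * x) * Im \<tau>)"
        by (simp add: algebra_simps flip: exp_add)
      finally show ?thesis by (simp add: mult_ac)
    qed
    thus ?thesis unfolding x_def[symmetric] using \<open>K \<ge> 0\<close>
      by (intro exI[of _ "exp (x * k) * K"]) auto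
  qed
  obtain K1 where K1: "K1 \<ge> 0" "\<And>\<tau>. Im \<tau> \<ge> h \<Longrightarrow>
      norm (logprod (zpow b) (of_rat (pos_rep a)) (- (2 * of_real pi * \<i> * \<tau>))) \<le>
     K1 * exp (- (2 * pi * of_rat (pos_rep a)) * Im \<tau>)" using * by blast
  obtain K2 where K2: "K2 \<ge> 0" "\<And>\<tau>. Im \<tau> \<ge> h \<Longrightarrow>
      norm (logprod (zpow (- b)) (of_rat (pos_rep (- a))) (- (2 * of_real pi * \<i> * \<tau>))) \<le>
     K2 * exp (- (2 * pi * of_rat (pos_rep (- a))) * Im \<tau>)" using * by blast
  have "norm (log_u a b \<tau>) \<le> (K1 + K2) * exp (- p * Im \<tau>)" if "Im \<tau> \<ge> h" for \<tau>
  proof -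
    have "K1 * exp (- (2 * pi * of_rat (pos_rep a)) * Im \<tau>) \<le> K1 * exp (- p * Im \<tau>)"
      "K2 * exp (- (2 * pi * of_rat (pos_rep (- a))) * Im \<tau>) \<le> K2 * exp (- p * Im \<tau>)"
      using K1 K2 that h by (auto simp: p_def intro!: mult_left_mono mult_right_mono)
    with K1(2)[OF that] K2(2)[OF that] show ?thesis unfolding log_u_def distrib_right
      by (intro order_trans[OF norm_triangle_ineq add_mono]) auto
  qed
  thus ?thesis by blast
qed

text \<open>On this line \<open>-2 pi i \<tau>\<close> has imaginary part
  \<open>-2 pi \<alpha> / n\<close>, so \<open>logprod_regroup\<close> applies with
  \<open>m = n\<close>. The shift of the phase has the same sign in both products, since only
  \<open>b\<close> and \<open>a\<close> are negated in the second one.\<close>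

lemma log_u_vertical:
  fixes \<alpha> :: int and n :: nat
  assumes "n > 0" "t > 0"
  shows "log_u a b (of_real (of_int \<alpha> / of_nat n) + \<i> * of_real t) =
    (\<Sum>l<n. logprod (zpow (b + of_int \<alpha> / of_nat n * (pos_rep a + of_nat l))) (of_rat ((pos_rep a +
      of_nat l) / of_nat n)) (of_real (2 * pi * n * t))) +
    (\<Sum>l<n. logprod (zpow (- b + of_int \<alpha> / of_nat n * (pos_rep (- a) + of_nat l)))
      (of_rat ((pos_rep (- a) + of_nat l) / of_nat n)) (of_real (2 * pi * n * t)))"
proof -
  define r where "r = real_of_int \<alpha> / of_nat n"
  define w where "w = - (2 * of_real pi * \<i> * (of_real r + \<i> * of_real t))"
  have w: "Re w = 2 * pi * t" "Im w = - 2 * pi * r"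
    by (simp_all add: w_def)
  have w_eq: "w = of_real (2 * pi * t) - \<i> * of_real (2 * pi * r)"
    by (simp add: complex_eq_iff w)
  have "of_nat n * w = of_real (n * Re w) - \<i> * of_real (2 * pi * \<alpha>)"
    unfolding w using assms by (simp add: complex_eq_iff w r_def)
  hence "exp (of_nat n * w) = exp (of_real (n * Re w)) / cis (2 * pi * \<alpha>)"
    by (simp add: exp_diff cis_conv_exp)
  also have "cis (2 * pi * \<alpha>) = 1"
    by (rule cis_multiple_2pi) auto
  finally have e: "exp (of_nat n * w) = of_real (exp (n * Re w))"
    unfolding exp_of_real by simp
  have "logprod (zpow b) (of_rat (pos_rep a)) w =
      (\<Sum>l<n. logprod (zpow (b + of_int \<alpha> / of_nat n * (pos_rep a + of_nat l)))
        (of_rat ((pos_rep a + of_nat l) / of_nat n)) (of_real (2 * pi * n * t)))" for a b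
  proof -
    have e1: "zpow b * exp (- ((of_real (of_rat (pos_rep a)) + of_nat l) * \<i> * of_real (Im w))) =
        zpow (b + of_int \<alpha> / of_nat n * (pos_rep a + of_nat l))" for l
      unfolding zpow_add w zpow_def[of "of_int \<alpha> / of_nat n * (pos_rep a + of_nat l)"]
      by (simp add: r_def of_rat_mult of_rat_add of_rat_divide complex_of_real_of_rat mult_ac)
    have e2: "(of_rat (pos_rep a) + real l) / real n = of_rat ((pos_rep a + of_nat l) / of_nat n)"
        for l
      by (simp add: of_rat_divide of_rat_add)
    have e3: "real n * Re w = 2 * pi * n * t" by (simp add: w)
    have "Re w > 0" using assms w by simp
    from logprod_regroup[OF norm_zpow of_rat_pos_rep_pos this assms(1) e, of b a] show ?thesis
      unfolding e1 e2 e3 .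
  qed
  thus ?thesis unfolding log_u_def w_def r_def by simp
qed

section \<open>Dedekind sums and boundary terms\<close>

lemma sum_shift_periodic:
  fixes G :: "int \<Rightarrow> 'a :: comm_monoid_add"
  assumes "m > 0" and per: "\<And>j k. G (j + k * m) = G j"
  shows "(\<Sum>j=0..<m. G (j - c)) = (\<Sum>j=0..<m. G j)"
proof -
  have red: "G (j mod m) = G j" for j
    using per[of "j mod m" "j div m"] by simp
  show ?thesis
  proof (rule sum.reindex_bij_witness[of _ "\<lambda>j. (j + c) mod m" "\<lambda>j. (j - c) mod m"])
    show "((j - c) mod m + c) mod m = j" if "j \<in> {0..<m}" for j
      using that by (simp add: mod_simps)
    show "((j + c) mod m - c) mod m = j" if "j \<in> {0..<m}" for j
      using that by (simp add: mod_simps)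
    show "G ((j - c) mod m) = G (j - c)" for j by (rule red)
  qed (use assms in auto)
qed

lemma sum_int_eq_sum_nat: "(\<Sum>j=0..<int n. f j) = (\<Sum>l<n. f (int l))"
  by (rule sum.reindex_bij_witness[of _ int nat]) auto

text \<open>Raising the index by \<open>n\<close> changes the arguments of the two \<open>B1\<close>
  factors by 1 and by \<open>\<alpha>\<close>. The summand is therefore periodic, and the sum may
  start at \<open>pos_rep a\<close> instead of \<open>a\<close>.\<close>

lemma dedekind_sum_pos_rep:
  assumes "n > 0"
  shows "dedekind_sum \<alpha> (int n) a b = (\<Sum>l<n. B1 ((pos_rep a + of_nat l) / of_nat n) *
      B1 (b + of_int \<alpha> / of_nat n * (pos_rep a + of_nat l)))"
proof -
  define c where "c = \<lceil>a\<rceil> - 1"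
  define G where "G = (\<lambda>j::int. B1 ((a + of_int j) / of_nat n) * B1 (b +
      of_int \<alpha> / of_nat n * (a + of_int j)))"
  have G: "G (j + k * int n) = G j" for j k
  proof -
    have "(a + of_int (j + k * int n)) / of_nat n = (a + of_int j) / of_nat n + of_int k"
      "b + of_int \<alpha> / of_nat n * (a + of_int (j + k * int n)) =
          b + of_int \<alpha> / of_nat n * (a + of_int j) + of_int (\<alpha> * k)"
      using assms by (simp_all add: field_simps)
    thus ?thesis unfolding G_def by (simp only: B1_add_Ints Ints_of_int)
  qed
  have eq: "a + of_int (int l - c) = pos_rep a + of_nat l" for l
    by (simp add: pos_rep_def c_def)
  have "{0..int n - 1} = {0..<int n}" by auto
  hence "dedekind_sum \<alpha> (int n) a b = (\<Sum>j=0..<int n. G j)"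
    unfolding dedekind_sum_def G_def by simp
  also have "\<dots> = (\<Sum>j=0..<int n. G (j - c))"
    using assms by (intro sum_shift_periodic[symmetric] G) auto
  also have "\<dots> = (\<Sum>l<n. G (int l - c))" by (rule sum_int_eq_sum_nat)
  also have "\<dots> = (\<Sum>l<n. B1 ((pos_rep a + of_nat l) / of_nat n) *
      B1 (b + of_int \<alpha> / of_nat n * (pos_rep a + of_nat l)))"
    unfolding G_def eq ..
  finally show ?thesis .
qed

text \<open>A phase exponent can be integral only if \<open>a * \<alpha> + b * n\<close> is. In that
  case \<open>\<alpha>\<close> is invertible modulo \<open>n\<close>, so exactly one index
  \<open>l0\<close> qualifies, and there \<open>a * x + b * y\<close> is congruent to
  \<open>- X l0\<close> modulo 1, which turns \<open>2 * sin\<close> into the norm of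
  \<open>1 - zpow\<close>.\<close>

lemma sum_delta_RClog_slash:
  fixes \<alpha> x y :: int
  assumes det: "\<alpha> * y - x * int n = 1" and n: "n > 0"
  shows "(\<Sum>l<n. if b + of_int \<alpha> / of_nat n * (pos_rep a + of_nat l) \<in> \<int>
      then ln (2 * sin (pi * of_rat ((pos_rep a + of_nat l) / of_nat n))) else 0) =
    delta0 (a * of_int \<alpha> + b * of_nat n) * ln (cmod (1 - zpow (a * of_int x + b * of_int y)))"
proof -
  define p where "p = pos_rep a"
  define c where "c = \<lceil>a\<rceil> - 1"
  define \<theta> where "\<theta> = (\<lambda>l::nat. b + of_int \<alpha> / of_nat n * (p + of_nat l))"
  define X where "X = (\<lambda>l::nat. (p + of_nat l) / of_nat n)"
  define g where "g = (\<lambda>l. ln (2 * sin (pi * of_rat (X l))))"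
  have a: "a = p + of_int c" by (simp add: p_def c_def pos_rep_def)
  have detq: "of_int \<alpha> * of_int y = (1 + of_int x * of_nat n :: rat)"
    using arg_cong[OF det, of "of_int :: int \<Rightarrow> rat"] by (simp add: algebra_simps)
  have n_theta: "of_nat n * \<theta> l = a * of_int \<alpha> + b * of_nat n + of_int (\<alpha> * (int l - c))" for l
    using n by (simp add: \<theta>_def a field_simps)
  have goal: "(\<Sum>l<n. if \<theta> l \<in> \<int> then g l else 0) =
    delta0 (a * of_int \<alpha> + b * of_nat n) * ln (cmod (1 - zpow (a * of_int x + b * of_int y)))"
  proof (cases "a * of_int \<alpha> + b * of_nat n \<in> \<int>")
    case False
    have "\<theta> l \<notin> \<int>" for l
    proof
      assume "\<theta> l \<in> \<int>"
      hence "of_nat n * \<theta> l - of_int (\<alpha> * (int l - c)) \<in> \<int>"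
        by (intro Ints_diff Ints_mult) auto
      with False show False unfolding n_theta by simp
    qed
    with False show ?thesis by (simp add: delta0_def)
  next
    case True
    then obtain A where A: "a * of_int \<alpha> + b * of_nat n = of_int A" by (auto elim: Ints_cases)
    have theta_iff: "\<theta> l \<in> \<int> \<longleftrightarrow> int n dvd A + \<alpha> * (int l - c)" for l
    proof
      assume "\<theta> l \<in> \<int>"
      then obtain k where "\<theta> l = of_int k" by (auto elim: Ints_cases)
      with n_theta[of l] A have "(of_int (int n * k) :: rat) = of_int (A + \<alpha> * (int l - c))" by simp
      hence "int n * k = A + \<alpha> * (int l - c)" by (simp only: of_int_eq_iff)
      thus "int n dvd A + \<alpha> * (int l - c)" by (metis dvd_triv_left)
    next
      assume "int n dvd A + \<alpha> * (int l - c)"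
      then obtain k where "A + \<alpha> * (int l - c) = int n * k" by (auto elim: dvdE)
      hence "(of_int (A + \<alpha> * (int l - c)) :: rat) = of_int (int n * k)" by simp
      with n_theta[of l] A have "of_nat n * \<theta> l = of_nat n * of_int k" by simp
      hence "\<theta> l = of_int k" using n by simp
      thus "\<theta> l \<in> \<int>" by simp
    qed
    \<comment> \<open>By the determinant condition \<open>y\<close> inverts \<open>\<alpha>\<close>
      modulo \<open>n\<close>, so this is the solution of
      \<open>A + \<alpha> * (l - c) \<equiv> 0\<close>.\<close>
    define l0 where "l0 = nat ((c - y * A) mod int n)"
    have l0: "l0 < n" "int l0 = (c - y * A) mod int n"
      using n by (auto simp: l0_def nat_less_iff)
    have dvd_iff: "int n dvd A + \<alpha> * (int l - c) \<longleftrightarrow> int n dvd int l - (c - y * A)" for l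
    proof -
      have 1: "int l - (c - y * A) = y * (A + \<alpha> * (int l - c)) - int n * (x * (int l - c))"
        using det by algebra
      have 2: "A + \<alpha> * (int l - c) = \<alpha> * (int l - (c - y * A)) - int n * (x * A)"
        using det by algebra
      show ?thesis
        by (metis 1 2 dvd_diff dvd_mult dvd_triv_left)
    qed
    have uniq: "\<theta> l \<in> \<int> \<longleftrightarrow> l = l0" if "l < n" for l
    proof -
      have "int n dvd int l - (c - y * A) \<longleftrightarrow> int l mod int n = (c - y * A) mod int n"
        by (simp add: mod_eq_dvd_iff)
      also have "\<dots> \<longleftrightarrow> l = l0" using that l0 by auto
      finally show ?thesis using theta_iff dvd_iff by blast
    qed
    have "(\<Sum>l<n. if \<theta> l \<in> \<int> then g l else 0) = (\<Sum>l<n. if l = l0 then g l else 0)"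
      by (intro sum.cong refl) (use uniq in auto)
    also have "\<dots> = g l0" using l0 by simp
    also have "g l0 = ln (cmod (1 - zpow (a * of_int x + b * of_int y)))"
    proof -
      have \<theta>0: "\<theta> l0 \<in> \<int>" using uniq l0 by blast
      \<comment> \<open>Multiply \<open>b = \<theta> l0 - \<alpha> * X l0\<close> by
        \<open>y\<close>, replace \<open>\<alpha> * y\<close> by \<open>1 + x * n\<close>, and use
        \<open>n * X l0 = p + l0\<close>.\<close>
      have "a * of_int x + b * of_int y + X l0 = \<theta> l0 * of_int y + of_int ((c - int l0) * x)"
      proof -
        have b: "b = \<theta> l0 - of_int \<alpha> * X l0" by (simp add: \<theta>_def X_def)
        have X: "p + of_nat l0 = of_nat n * X l0" using n by (simp add: X_def)
        have "b * of_int y = \<theta> l0 * of_int y - (of_int \<alpha> * of_int y) * X l0"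
          by (simp add: b algebra_simps)
        also have "\<dots> = \<theta> l0 * of_int y - X l0 - of_int x * (of_nat n * X l0)"
          unfolding detq by (simp add: algebra_simps)
        finally show ?thesis unfolding X[symmetric] a by (simp add: algebra_simps)
      qed
      hence "a * of_int x + b * of_int y - (- X l0) \<in> \<int>"
        using \<theta>0 by (simp add: Ints_add Ints_mult)
      hence "zpow (a * of_int x + b * of_int y) = zpow (- X l0)" by (rule zpow_cong)
      hence "cmod (1 - zpow (a * of_int x + b * of_int y)) = \<bar>2 * sin (pi * of_rat (X l0))\<bar>"
        by (simp add: norm_one_minus_zpow of_rat_minus)
      moreover have "sin (pi * of_rat (X l0)) \<ge> 0"
      proof (rule sin_ge_zero)
        have "0 \<le> X l0" using pos_rep_pos[of a] n by (simp add: X_def p_def)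
        moreover have "X l0 \<le> 1"
        proof -
          have "p + of_nat l0 \<le> 1 + of_nat l0" using pos_rep_le_1[of a] by (simp add: p_def)
          also have "\<dots> = of_nat (Suc l0)" by simp
          also have "\<dots> \<le> of_nat n" using l0 by (simp only: of_nat_le_iff Suc_le_eq)
          finally show ?thesis using n by (simp add: X_def)
        qed
        ultimately show "0 \<le> pi * of_rat (X l0)" "pi * of_rat (X l0) \<le> pi"
          by (simp_all add: of_rat_le_1_iff)
      qed
      ultimately show ?thesis by (simp add: g_def)
    qed
    finally show ?thesis using True by (simp add: delta0_def)
  qed
  thus ?thesis unfolding \<theta>_def g_def X_def p_def .
qed

section \<open>Constant term of the logarithm at a cusp\<close>

lemma B1_of_unit_interval: "0 < q \<Longrightarrow> q < 1 \<Longrightarrow> B1 q = q - 1 / 2"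
proof -
  assume q: "0 < q" "q < 1"
  hence "\<lfloor>q\<rfloor> = 0" by (simp add: floor_eq_iff)
  moreover from this q have "q \<notin> \<int>" by (auto elim!: Ints_cases)
  ultimately show ?thesis by (simp add: B1_def)
qed

lemma pos_rep_Ints: "a \<in> \<int> \<Longrightarrow> pos_rep a = 1"
  by (auto elim!: Ints_cases simp: pos_rep_def)

lemma pos_rep_minus_notin_Ints:
  assumes "a \<notin> \<int>"
  shows "pos_rep a + pos_rep (- a) = 1"
proof -
  have "\<lceil>a\<rceil> = \<lfloor>a\<rfloor> + 1"
    using assms by (metis Ints_of_int ceiling_altdef)
  thus ?thesis by (simp add: pos_rep_def ceiling_minus)
qed

section \<open>Pairing the residue classes of the two products\<close>

context
  fixes a b :: rat and \<alpha> :: int and n :: nat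
    and p p' :: rat and \<theta> \<theta>' X X' :: "nat \<Rightarrow> rat"
  assumes n: "n > 0"
  defines "p \<equiv> pos_rep a" and "p' \<equiv> pos_rep (- a)"
    and "\<theta> \<equiv> \<lambda>l. b + of_int \<alpha> / of_nat n * (p + of_nat l)"
    and "\<theta>' \<equiv> \<lambda>l. - b + of_int \<alpha> / of_nat n * (p' + of_nat l)"
    and "X \<equiv> \<lambda>l. (p + of_nat l) / of_nat n"
    and "X' \<equiv> \<lambda>l. (p' + of_nat l) / of_nat n"
begin

text \<open>Class \<open>l\<close> of the first product is matched with class
  \<open>m - 1 - l\<close> of the second; the hypothesis on \<open>m\<close> says that their offsets
  add up to 1. It holds with \<open>m = n\<close> if \<open>a\<close> is not an integer, and with
  \<open>m = n - 1\<close> if it is, as then \<open>p = p' = 1\<close>.\<close>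

lemma paired_sum_asymp:
  assumes m: "p + p' + of_nat m = of_nat n + 1"
  shows "\<exists>A. ((\<lambda>s. (\<Sum>l<m. logprod (zpow (\<theta> l)) (of_rat (X l)) (of_real s)) +
      (\<Sum>l<m. logprod (zpow (\<theta>' l)) (of_rat (X' l)) (of_real s)) + A / of_real s) \<longlongrightarrow>
    (\<Sum>l<m. of_real (if \<theta> l \<in> \<int> then ln (2 * sin (pi * of_rat (X l))) else 0)
      - 2 * of_real pi * \<i> * of_rat (B1 (X l) * B1 (\<theta> l)))) (at_right 0)"
proof -
  have reflect: "X' (m - Suc l) = 1 - X l" "zpow (\<theta>' (m - Suc l)) = zpow (- \<theta> l)" if "l < m" for l
  proof -
    have eq: "p' + of_nat (m - Suc l) = of_nat n - (p + of_nat l)"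
      using m that by (simp add: of_nat_diff)
    show "X' (m - Suc l) = 1 - X l"
      unfolding X'_def X_def eq using n by (simp add: diff_divide_distrib)
    \<comment> \<open>The numerators of the two offsets add up to \<open>n\<close>, so the phase
      exponents add up to the integer \<open>\<alpha>\<close>.\<close>
    have "\<theta>' (m - Suc l) - (- \<theta> l) = of_int \<alpha>"
      unfolding \<theta>'_def \<theta>_def eq using n by (simp add: field_simps)
    thus "zpow (\<theta>' (m - Suc l)) = zpow (- \<theta> l)" by (intro zpow_cong) simp
  qed
  have X01: "0 < X l" "X l < 1" if "l < m" for l
  proof -
    show "0 < X l" using pos_rep_pos[of a] n by (simp add: X_def p_def add_pos_nonneg)
    have "of_nat (Suc l) \<le> (of_nat m :: rat)" using that by (simp only: of_nat_le_iff Suc_le_eq)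
    hence "p + of_nat l < of_nat n" using m pos_rep_pos[of "- a"] unfolding p'_def by simp
    thus "X l < 1" using n by (simp add: X_def)
  qed
  have "((\<lambda>s. \<Sum>l<m. logprod (zpow (\<theta> l)) (of_rat (X l)) (of_real s) +
        logprod (zpow (- \<theta> l)) (1 - of_rat (X l)) (of_real s) +
        (dilog (zpow (\<theta> l)) 0 + dilog (zpow (- \<theta> l)) 0) / of_real s) \<longlongrightarrow>
      (\<Sum>l<m. of_real (if \<theta> l \<in> \<int> then ln (2 * sin (pi * of_rat (X l))) else 0)
        - 2 * of_real pi * \<i> * of_real (of_rat (X l) - 1/2) * of_rat (B1 (\<theta> l)))) (at_right 0)"
    by (intro tendsto_sum logprod_pair_asymp) (use X01 in \<open>auto simp: of_rat_less_1_iff\<close>)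
  also have "(\<Sum>l<m. of_real (if \<theta> l \<in> \<int> then ln (2 * sin (pi * of_rat (X l))) else 0)
        - 2 * of_real pi * \<i> * of_real (of_rat (X l) - 1/2) * of_rat (B1 (\<theta> l))) =
      (\<Sum>l<m. complex_of_real (if \<theta> l \<in> \<int> then ln (2 * sin (pi * of_rat (X l))) else 0)
        - 2 * of_real pi * \<i> * of_rat (B1 (X l) * B1 (\<theta> l)))"
  proof (intro sum.cong refl)
    fix l assume "l \<in> {..<m}"
    hence "complex_of_real (of_rat (X l) - 1/2) = of_rat (B1 (X l))"
      using X01[of l]
          by (simp add: B1_of_unit_interval of_rat_diff of_rat_divide complex_of_real_of_rat)
    thus "of_real (if \<theta> l \<in> \<int> then ln (2 * sin (pi * of_rat (X l))) else 0)
        - 2 * of_real pi * \<i> * of_real (of_rat (X l) - 1/2) * of_rat (B1 (\<theta> l)) =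
      complex_of_real (if \<theta> l \<in> \<int> then ln (2 * sin (pi * of_rat (X l))) else 0)
        - 2 * of_real pi * \<i> * of_rat (B1 (X l) * B1 (\<theta> l))"
      by (simp only: of_rat_mult mult.assoc)
  qed
  also have "(\<lambda>s. \<Sum>l<m. logprod (zpow (\<theta> l)) (of_rat (X l)) (of_real s) +
        logprod (zpow (- \<theta> l)) (1 - of_rat (X l)) (of_real s) +
        (dilog (zpow (\<theta> l)) 0 + dilog (zpow (- \<theta> l)) 0) / of_real s) =
     (\<lambda>s. (\<Sum>l<m. logprod (zpow (\<theta> l)) (of_rat (X l)) (of_real s)) +
      (\<Sum>l<m. logprod (zpow (\<theta>' l)) (of_rat (X' l)) (of_real s)) +
      (\<Sum>l<m. dilog (zpow (\<theta> l)) 0 + dilog (zpow (- \<theta> l)) 0) / of_real s)"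
  proof
    fix s
    have "(\<Sum>l<m. logprod (zpow (\<theta>' l)) (of_rat (X' l)) (of_real s)) =
       (\<Sum>l<m. logprod (zpow (\<theta>' (m - Suc l))) (of_rat (X' (m - Suc l))) (of_real s))"
      by (rule sum.nat_diff_reindex[symmetric])
    also have "\<dots> = (\<Sum>l<m. logprod (zpow (- \<theta> l)) (1 - of_rat (X l)) (of_real s))"
      by (intro sum.cong) (auto simp: reflect of_rat_diff)
    finally show "(\<Sum>l<m. logprod (zpow (\<theta> l)) (of_rat (X l)) (of_real s) +
        logprod (zpow (- \<theta> l)) (1 - of_rat (X l)) (of_real s) +
        (dilog (zpow (\<theta> l)) 0 + dilog (zpow (- \<theta> l)) 0) / of_real s) =
      (\<Sum>l<m. logprod (zpow (\<theta> l)) (of_rat (X l)) (of_real s)) +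
      (\<Sum>l<m. logprod (zpow (\<theta>' l)) (of_rat (X' l)) (of_real s)) +
      (\<Sum>l<m. dilog (zpow (\<theta> l)) 0 + dilog (zpow (- \<theta> l)) 0) / of_real s"
      by (simp add: sum.distrib sum_divide_distrib add_divide_distrib)
  qed
  finally show ?thesis by blast
qed

text \<open>For integral \<open>a\<close> the last class of each product stays unpaired. Both have
  offset 1 and phases \<open>zpow b\<close> and \<open>zpow (- b)\<close>, with \<open>b\<close> not
  an integer, so together they give the boundary term of \<open>f\<close>.\<close>

lemma full_sum_asymp:
  assumes ab: "\<not> (a \<in> \<int> \<and> b \<in> \<int>)"
  shows "\<exists>A. ((\<lambda>s. (\<Sum>l<n. logprod (zpow (\<theta> l)) (of_rat (X l)) (of_real s)) +
      (\<Sum>l<n. logprod (zpow (\<theta>' l)) (of_rat (X' l)) (of_real s)) + A / of_real s) \<longlongrightarrow>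
    (\<Sum>l<n. of_real (if \<theta> l \<in> \<int> then ln (2 * sin (pi * of_rat (X l))) else 0)
      - 2 * of_real pi * \<i> * of_rat (B1 (X l) * B1 (\<theta> l)))
    - of_real (delta0 a * ln (cmod (1 - zpow b)))) (at_right 0)"
proof (cases "a \<in> \<int>")
  case False
  have "p + p' + of_nat n = of_nat n + 1"
    using pos_rep_minus_notin_Ints[OF False] by (simp add: p_def p'_def)
  from paired_sum_asymp[OF this] False show ?thesis by (simp add: delta0_def)
next
  case True
  hence b: "b \<notin> \<int>" using ab by blast
  have pp: "p = 1" "p' = 1" using True by (auto simp: p_def p'_def pos_rep_Ints)
  obtain m where m: "n = Suc m" using n gr0_implies_Suc by blast
  have "p + p' + of_nat m = of_nat n + 1" by (simp add: pp m)
  from paired_sum_asymp[OF this] obtain A where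
    A: "((\<lambda>s. (\<Sum>l<m. logprod (zpow (\<theta> l)) (of_rat (X l)) (of_real s)) +
      (\<Sum>l<m. logprod (zpow (\<theta>' l)) (of_rat (X' l)) (of_real s)) + A / of_real s) \<longlongrightarrow>
    (\<Sum>l<m. of_real (if \<theta> l \<in> \<int> then ln (2 * sin (pi * of_rat (X l))) else 0)
      - 2 * of_real pi * \<i> * of_rat (B1 (X l) * B1 (\<theta> l)))) (at_right 0)" by blast
  have Xm: "X m = 1" "X' m = 1"
    unfolding X_def X'_def pp m by simp_all
  have \<theta>m: "\<theta> m = b + of_int \<alpha>" "\<theta>' m = - b + of_int \<alpha>"
    unfolding \<theta>_def \<theta>'_def pp m by simp_all
  have zm: "zpow (\<theta> m) = zpow b" "zpow (\<theta>' m) = zpow (- b)"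
    unfolding \<theta>m by (auto intro!: zpow_cong)
  have "\<theta> m \<notin> \<int>"
    using b Ints_diff[of "\<theta> m" "of_int \<alpha>"] by (auto simp: \<theta>m)
  moreover have "B1 1 = 0" by (simp add: B1_def)
  \<comment> \<open>The additional index \<open>m\<close> contributes nothing to the sum: its phase
    exponent is not integral, and \<open>B1 1 = 0\<close> by the convention at integers.\<close>
  ultimately have limit: "(\<Sum>l<n. of_real (if \<theta> l \<in> \<int> then ln (2 * sin (pi * of_rat (X l))) else 0)
      - 2 * of_real pi * \<i> * of_rat (B1 (X l) * B1 (\<theta> l))) =
     (\<Sum>l<m. complex_of_real (if \<theta> l \<in> \<int> then ln (2 * sin (pi * of_rat (X l))) else 0)
      - 2 * of_real pi * \<i> * of_rat (B1 (X l) * B1 (\<theta> l)))"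
    by (simp add: m Xm)
  define D where "D = dilog (zpow b) 0 + dilog (zpow (- b)) 0"
  have fn: "(\<lambda>s. (\<Sum>l<n. logprod (zpow (\<theta> l)) (of_rat (X l)) (of_real s)) +
      (\<Sum>l<n. logprod (zpow (\<theta>' l)) (of_rat (X' l)) (of_real s)) + (A + D) / of_real s) =
    (\<lambda>s. ((\<Sum>l<m. logprod (zpow (\<theta> l)) (of_rat (X l)) (of_real s)) +
      (\<Sum>l<m. logprod (zpow (\<theta>' l)) (of_rat (X' l)) (of_real s)) + A / of_real s) +
      (logprod (zpow b) 1 (of_real s) + logprod (zpow (- b)) 1 (of_real s) + D / of_real s))"
    by (simp add: m Xm zm add_divide_distrib fun_eq_iff)
  have "((\<lambda>s. (\<Sum>l<n. logprod (zpow (\<theta> l)) (of_rat (X l)) (of_real s)) +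
      (\<Sum>l<n. logprod (zpow (\<theta>' l)) (of_rat (X' l)) (of_real s)) + (A + D) / of_real s) \<longlongrightarrow>
    (\<Sum>l<n. of_real (if \<theta> l \<in> \<int> then ln (2 * sin (pi * of_rat (X l))) else 0)
      - 2 * of_real pi * \<i> * of_rat (B1 (X l) * B1 (\<theta> l)))
    + (- of_real (ln (cmod (1 - zpow b))))) (at_right 0)"
    unfolding fn limit unfolding D_def by (rule tendsto_add[OF A logprod_integer_pair_asymp[OF b]])
  thus ?thesis using True by (intro exI[of _ "A + D"]) (simp add: delta0_def)
qed

lemma log_u_asymp:
  assumes ab: "\<not> (a \<in> \<int> \<and> b \<in> \<int>)" and det: "\<alpha> * y - x * int n = 1"
  shows "\<exists>A. ((\<lambda>t. log_u a b (of_real (of_int \<alpha> / of_nat n) + \<i> * of_real t) + A / of_real t) \<longlongrightarrow>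
    of_real (delta0 (a * of_int \<alpha> + b * of_nat n) * ln (cmod (1 - zpow (a * of_int x +
        b * of_int y)))
      - delta0 a * ln (cmod (1 - zpow b)))
    - 2 * of_real pi * \<i> * of_rat (dedekind_sum \<alpha> (int n) a b)) (at_right 0)" (is "\<exists>A. (_ \<longlongrightarrow> ?M) _")
proof -
  have M: "(\<Sum>l<n. of_real (if \<theta> l \<in> \<int> then ln (2 * sin (pi * of_rat (X l))) else 0)
      - 2 * of_real pi * \<i> * of_rat (B1 (X l) * B1 (\<theta> l)))
    - of_real (delta0 a * ln (cmod (1 - zpow b))) = ?M"
    unfolding sum_delta_RClog_slash[OF det n, symmetric] dedekind_sum_pos_rep[OF n]
    unfolding \<theta>_def X_def p_def
    by (simp add: sum_subtractf sum_distrib_left of_rat_sum)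
  obtain A where A: "((\<lambda>s. (\<Sum>l<n. logprod (zpow (\<theta> l)) (of_rat (X l)) (of_real s)) +
      (\<Sum>l<n. logprod (zpow (\<theta>' l)) (of_rat (X' l)) (of_real s)) + A / of_real s) \<longlongrightarrow> ?M) (at_right 0)"
    using full_sum_asymp[OF ab] unfolding M by blast
  \<comment> \<open>The grouped products are evaluated at \<open>s = 2 * pi * n * t\<close>; this
    rescaling of \<open>t\<close> affects only the pole coefficient.\<close>
  have "2 * pi * real n > 0" using n by simp
  hence "filterlim (\<lambda>t::real. 2 * pi * real n * t) (at_right 0) (at_right 0)"
    by real_asymp
  from filterlim_compose[OF A this]
  have "((\<lambda>t. log_u a b (of_real (of_int \<alpha> / of_nat n) + \<i> * of_real t) +
      (A / of_real (2 * pi * n)) / of_real t) \<longlongrightarrow> ?M) (at_right 0)"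
  proof (rule Lim_transform_eventually)
    show "\<forall>\<^sub>F t in at_right 0. (\<Sum>l<n. logprod (zpow (\<theta> l)) (of_rat (X l))
        (of_real (2 * pi * real n * t))) +
      (\<Sum>l<n. logprod (zpow (\<theta>' l)) (of_rat (X' l)) (of_real (2 * pi * real n * t))) +
        A / of_real (2 * pi * real n * t) =
      log_u a b (of_real (of_int \<alpha> / of_nat n) + \<i> * of_real t) + (A / of_real (2 * pi * n))
          / of_real t"
      using eventually_at_right_less[of 0]
    proof eventually_elim
      case (elim t)
      show ?case unfolding log_u_vertical[OF n elim] \<theta>_def \<theta>'_def X_def X'_def p_def p'_def by simp
    qed
  qed
  thus ?thesis by blast
qed

end

theorem mainTheorem3:
  fixes a b :: rat and \<alpha> \<beta> x y :: int and f :: "rat \<times> rat \<Rightarrow> int"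
  assumes "\<not> (a \<in> \<int> \<and> b \<in> \<int>)"
    and "f = coset_fun (a, b)"
    and "\<alpha> * y - x * \<beta> = 1"
    and "\<beta> > 0"
  shows "fp_integrable (vertical_pullback (dlog (u f)) (of_int \<alpha> / of_int \<beta>)) \<and>
    1 / (2 * of_real pi * \<i>) *
      fp_integral (vertical_pullback (dlog (u f)) (of_int \<alpha> / of_int \<beta>)) =
    of_rat (dedekind_sum \<alpha> \<beta> a b) -
      1 / (2 * of_real pi * \<i>) *
        of_real (delta0_RClog (slash f \<alpha> x \<beta> y) - delta0_RClog f)"
proof -
  define n where "n = nat \<beta>"
  have \<beta>: "\<beta> = int n" and n: "n > 0" using assms(4) by (auto simp: n_def)
  define \<Delta> where "\<Delta> = delta0_RClog (slash f \<alpha> x \<beta> y) - delta0_RClog f"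
  define C where "C = complex_of_rat (dedekind_sum \<alpha> \<beta> a b)"
  have u: "u f = u_prod a b" by (simp add: assms(2) u_coset_fun)
  have \<Delta>: "\<Delta> = delta0 (a * of_int \<alpha> + b * of_nat n) * ln (cmod (1 - zpow (a * of_int x +
      b * of_int y)))
      - delta0 a * ln (cmod (1 - zpow b))"
    unfolding \<Delta>_def assms(2) slash_coset_fun[OF assms(3)] delta0_RClog_coset_fun by (simp add: \<beta>)
  obtain A where A: "((\<lambda>t. log_u a b (of_real (of_int \<alpha> / of_nat n) + \<i> * of_real t) +
      A / of_real t) \<longlongrightarrow>
      of_real \<Delta> - 2 * of_real pi * \<i> * C) (at_right 0)"
    using log_u_asymp[OF n assms(1) assms(3)[unfolded \<beta>]] unfolding \<Delta> C_def \<beta> by blast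
  \<comment> \<open>Positivity of the decay rate from \<open>log_u_decay\<close>.\<close>
  have "2 * pi * min (real_of_rat (pos_rep a)) (real_of_rat (pos_rep (- a))) > 0"
    using of_rat_pos_rep_pos by (simp add: min_def)
  from has_fp_integral_simple_pole[OF holomorphic_log_u u_prod_eq_exp this log_u_decay A]
  have fp: "has_fp_integral (vertical_pullback (dlog (u f)) (of_int \<alpha> / of_int \<beta>))
      (- (of_real \<Delta> - 2 * of_real pi * \<i> * C))"
    unfolding u by (simp add: \<beta>)
  hence "fp_integrable (vertical_pullback (dlog (u f)) (of_int \<alpha> / of_int \<beta>))"
    unfolding fp_integrable_def by blast
  moreover have "1 / (2 * of_real pi * \<i>) * (- (of_real \<Delta> - 2 * of_real pi * \<i> * C)) =
      C - 1 / (2 * of_real pi * \<i>) * of_real \<Delta>"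
    by (simp add: field_simps)
  ultimately show ?thesis
    unfolding fp_integral_eqI[OF fp] \<Delta>_def C_def by blast
qed

end
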